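(* Let $0<\theta<1$, $\lambda>0$, and $\beta=\frac1m$ with $m\in\{2,3,\dots\}$. Let $\{Y_n\}$ be a stationary AR(1) process satisfying $$Y_n=\begin{cases}\epsilon_n, & \text{with probability } \theta,\\ Y_{n-1}+\epsilon_n, & \text{with probability } 1-\theta,\end{cases}$$ whose marginals are geometric tempered stable, with Laplace transform $\phi_Y(s)=\frac{1}{1+(s+\lambda)^\beta-\lambda^\beta}$. Then the innovation terms $\{\epsilon_n\}$ also follow a geometric tempered stable distribution, with Laplace transform $\phi_\epsilon(s)=\frac{1}{1+\theta((s+\lambda)^\beta-\lambda^\beta)}$. Moreover, the probability density function of the innovation terms has the integral form $$f_\epsilon(x)=\frac{e^{(s_0-\lambda)x}}{\theta\beta s_0^{\beta-1}}+\frac1\pi\int_0^\infty\frac{\theta e^{-x(y+\lambda)}y^\beta\sin(\pi\beta)}{1+2\theta(y^\beta\cos(\pi\beta)-\lambda^\beta)+\theta^2(y^{2\beta}-2\lambda^\beta y^\beta\cos(\pi\beta)+\lambda^{2\beta})}\,dy,$$ where $s_0=(\lambda^\beta-1/\theta)^{1/\beta}$.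
   Context: The Laplace transform of a nonnegative random variable $Z$ is $\phi_Z(s)=\mathbb{E}[e^{-sZ}]$, $s>0$. In the AR(1) process the innovations $\epsilon_n$ are i.i.d., $\epsilon_n$ is independent of $Y_{n-1},Y_{n-2},\dots$, and the random choice between the two alternatives at time $n$ is independent of $\epsilon_n$ and of the past.
   Formalization: The exponential term with s_0 is kept only when λ^β > 1/θ and is taken as 0 otherwise; the printed formula fails there (m=2, θ=1/2, λ=1 makes that term the constant 4, so f_ε is not integrable). *)

theory Defs
  imports "HOL-Probability.Probability"
begin

definition laplace_transform :: "'a measure \<Rightarrow> ('a \<Rightarrow> real) \<Rightarrow> real \<Rightarrow> real" where
  "laplace_transform M Z s = (\<integral>\<omega>. exp (- s * Z \<omega>) \<partial>M)"

(* The Laplace exponent of a tempered stable subordinator is c ((s + lam)^b - lam^b); evaluating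
   the subordinator at an independent standard exponential time gives the transform below.
   The scale c > 0 is a free parameter of the family. *)
definition geometric_tempered_stable :: "'a measure \<Rightarrow> real \<Rightarrow> real \<Rightarrow> ('a \<Rightarrow> real) \<Rightarrow> bool" where
  "geometric_tempered_stable M lam \<beta> Z \<longleftrightarrow>
     Z \<in> borel_measurable M \<and> (AE \<omega> in M. 0 \<le> Z \<omega>) \<and>
     (\<exists>c>0. \<forall>s>0. laplace_transform M Z s = 1 / (1 + c * ((s + lam) powr \<beta> - lam powr \<beta>)))"

context prob_space
begin

(* Independence of random elements whose value spaces may have different types
   (indep_var requires both to have the same type). *)
definition indep_elements ::
  "'b measure \<Rightarrow> ('a \<Rightarrow> 'b) \<Rightarrow> 'c measure \<Rightarrow> ('a \<Rightarrow> 'c) \<Rightarrow> bool" where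
  "indep_elements N1 X N2 Z \<longleftrightarrow> X \<in> measurable M N1 \<and> Z \<in> measurable M N2 \<and>
     indep_set {X -` A \<inter> space M | A. A \<in> sets N1} {Z -` A \<inter> space M | A. A \<in> sets N2}"

(* Strict stationarity: the finite-dimensional distributions are invariant under time shifts. *)
definition stationary :: "(nat \<Rightarrow> 'a \<Rightarrow> real) \<Rightarrow> bool" where
  "stationary Y \<longleftrightarrow> (\<forall>n. Y n \<in> borel_measurable M) \<and>
     (\<forall>J h. finite J \<longrightarrow>
        distr M (Pi\<^sub>M J (\<lambda>_. borel)) (\<lambda>\<omega>. \<lambda>n\<in>J. Y (n + h) \<omega>) =
        distr M (Pi\<^sub>M J (\<lambda>_. borel)) (\<lambda>\<omega>. \<lambda>n\<in>J. Y n \<omega>))"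

end

(* B n \<omega> is the outcome of the random choice at time n: True selects the alternative Y n = \<epsilon> n.
   The recursion starts from Y 0 and runs over n \<ge> 1; a process indexed by all integers
   satisfies these conditions after restriction to times \<ge> 0. *)
locale ar1_process = prob_space M for M :: "'a measure" +
  fixes \<theta> :: real
    and B :: "nat \<Rightarrow> 'a \<Rightarrow> bool"
    and \<epsilon> Y :: "nat \<Rightarrow> 'a \<Rightarrow> real"
  assumes Y_measurable: "\<And>n. Y n \<in> borel_measurable M"
    and innovations_indep: "indep_vars (\<lambda>_. borel) \<epsilon> {1..}"
    and innovations_identically_distributed:
      "\<And>n. 1 \<le> n \<Longrightarrow> distr M borel (\<epsilon> n) = distr M borel (\<epsilon> 1)"
    and innovation_indep_past: "\<And>n. 1 \<le> n \<Longrightarrow>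
      indep_elements borel (\<epsilon> n) (Pi\<^sub>M {..<n} (\<lambda>_. borel)) (\<lambda>\<omega>. \<lambda>k\<in>{..<n}. Y k \<omega>)"
    and choice_indep: "\<And>n. 1 \<le> n \<Longrightarrow>
      indep_elements (count_space UNIV) (B n)
        (borel \<Otimes>\<^sub>M Pi\<^sub>M {..<n} (\<lambda>_. borel)) (\<lambda>\<omega>. (\<epsilon> n \<omega>, \<lambda>k\<in>{..<n}. Y k \<omega>))"
    and choice_prob: "\<And>n. 1 \<le> n \<Longrightarrow> prob {\<omega> \<in> space M. B n \<omega>} = \<theta>"
    and recursion: "\<And>n. 1 \<le> n \<Longrightarrow>
      AE \<omega> in M. Y n \<omega> = (if B n \<omega> then \<epsilon> n \<omega> else Y (n - 1) \<omega> + \<epsilon> n \<omega>)"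

definition s0 :: "real \<Rightarrow> real \<Rightarrow> real \<Rightarrow> real" where
  "s0 \<theta> lam \<beta> = (lam powr \<beta> - 1 / \<theta>) powr (1 / \<beta>)"

(* The residue of exp (x (u - lam)) / (1 + \<theta> (u^\<beta> - lam^\<beta>)) at its pole u = s0. On the principal
   branch of u^\<beta> (0 < \<beta> < 1) there is such a pole only for 1/\<theta> < lam^\<beta>; otherwise the
   residue term is absent. Keeping it with a power of a nonpositive base would be wrong: for
   \<beta> = 1/2, \<theta> = 1/2, lam = 1 one has (lam^\<beta> - 1/\<theta>)^2 = 1 and the term would be the constant 4,
   whereas the integral term alone already has total mass 1. *)
definition residue_term :: "real \<Rightarrow> real \<Rightarrow> real \<Rightarrow> real \<Rightarrow> real" where
  "residue_term \<theta> lam \<beta> x =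
     (if 1 / \<theta> < lam powr \<beta>
      then exp ((s0 \<theta> lam \<beta> - lam) * x) / (\<theta> * \<beta> * s0 \<theta> lam \<beta> powr (\<beta> - 1))
      else 0)"

definition cut_integrand :: "real \<Rightarrow> real \<Rightarrow> real \<Rightarrow> real \<Rightarrow> real \<Rightarrow> real" where
  "cut_integrand \<theta> lam \<beta> x y =
     \<theta> * exp (- x * (y + lam)) * y powr \<beta> * sin (pi * \<beta>) /
     (1 + 2 * \<theta> * (y powr \<beta> * cos (pi * \<beta>) - lam powr \<beta>)
        + \<theta>\<^sup>2 * (y powr (2 * \<beta>) - 2 * lam powr \<beta> * y powr \<beta> * cos (pi * \<beta>) + lam powr (2 * \<beta>)))"

definition innovation_density :: "real \<Rightarrow> real \<Rightarrow> real \<Rightarrow> real \<Rightarrow> real" where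
  "innovation_density \<theta> lam \<beta> x =
     residue_term \<theta> lam \<beta> x + 1 / pi * (LINT y:{0<..}|lborel. cut_integrand \<theta> lam \<beta> x y)"

end

theory Submission
  imports Defs "HOL-Complex_Analysis.Complex_Analysis" "HOL-Real_Asymp.Real_Asymp"
begin

text \<open>
  On \<open>B n\<close> one has \<open>Y n = \<epsilon> n\<close>, so by independence the transforms satisfy
  \<open>\<phi>\<^sub>Y = \<phi>\<^sub>\<epsilon> (\<theta> + (1 - \<theta>) \<phi>\<^sub>Y)\<close>, which is solved for \<open>\<phi>\<^sub>\<epsilon>\<close>.
  By Tonelli, the transform of the claimed density at \<open>u - lam\<close> reduces to the integral over \<open>y > 0\<close> of
  \<open>y\<^sup>\<beta> sin (\<pi>\<beta>) / ((y + u) \<bar>c + y\<^sup>\<beta> exp (i\<pi>\<beta>)\<bar>\<^sup>2)\<close> with \<open>c = 1/\<theta> - lam\<^sup>\<beta>\<close>.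
  Since \<open>\<beta> = 1/m\<close>, the substitution \<open>y = t\<^sup>m\<close>, \<open>u = v\<^sup>m\<close> makes the integrand rational: one integrates the imaginary
  part of \<open>- m w\<^bsup>m-1\<^esup> / ((w\<^sup>m - v\<^sup>m) (w + c)) dw\<close> along the ray at angle \<open>\<pi>/m\<close>. This function is real on the
  positive axis, and its only poles in the sector between the axis and the ray are \<open>v\<close> and, if \<open>c < 0\<close>, the
  point \<open>- c = s0\<^sup>\<beta>\<close>, both on the axis; the latter produces the residue term.
\<close>

section \<open>Integrals along the side of a sector\<close>

text \<open>Encoded by two closed half planes, so that convexity is linear. For
  \<open>0 < \<alpha> < pi\<close> the set consists of 0 and the points with argument in
  \<open>[0, \<alpha>]\<close>.\<close>

definition sector :: "real \<Rightarrow> complex set" where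
  "sector \<alpha> = {w. 0 \<le> Im w \<and> Im (w * cis (- \<alpha>)) \<le> 0}"

lemma convex_sector: "convex (sector \<alpha>)"
proof (rule convexI)
  fix x y :: complex and a b :: real
  assume xy: "x \<in> sector \<alpha>" "y \<in> sector \<alpha>" and ab: "0 \<le> a" "0 \<le> b" "a + b = 1"
  have "Im ((a *\<^sub>R x + b *\<^sub>R y) * cis (- \<alpha>)) = a * Im (x * cis (- \<alpha>)) + b * Im (y * cis (- \<alpha>))"
    by (simp add: algebra_simps)
  moreover have "a * Im (x * cis (- \<alpha>)) \<le> 0" "b * Im (y * cis (- \<alpha>)) \<le> 0"
    using xy ab by (auto simp only: sector_def mem_Collect_eq intro!: mult_nonneg_nonpos)
  moreover have "0 \<le> a * Im x" "0 \<le> b * Im y"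
    using xy ab by (auto simp: sector_def)
  ultimately show "a *\<^sub>R x + b *\<^sub>R y \<in> sector \<alpha>"
    by (simp add: sector_def)
qed

lemma rcis_in_sector:
  assumes "0 \<le> r" "0 \<le> \<phi>" "\<phi> \<le> \<alpha>" "\<alpha> \<le> pi"
  shows "rcis r \<phi> \<in> sector \<alpha>"
proof -
  have "Im (rcis r \<phi> * cis (- \<alpha>)) = - (r * sin (\<alpha> - \<phi>))"
    by (simp add: rcis_def sin_diff algebra_simps)
  moreover have "0 \<le> r * sin (\<alpha> - \<phi>)" "0 \<le> r * sin \<phi>"
    using assms by (auto intro!: mult_nonneg_nonneg sin_ge_zero)
  ultimately show ?thesis
    unfolding sector_def by (simp only: mem_Collect_eq Im_rcis neg_le_0_iff_le)
qed

lemma sector_cases: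
  assumes "w \<in> sector \<alpha>" "0 < \<alpha>" "\<alpha> < pi"
  obtains r \<phi> where "0 \<le> r" "0 \<le> \<phi>" "\<phi> \<le> \<alpha>" "w = rcis r \<phi>"
proof (cases "w = 0")
  case True
  then show ?thesis using assms by (intro that[of 0 0]) auto
next
  case False
  define r \<phi> where "r = cmod w" and "\<phi> = Arg w"
  have r: "0 < r" and w: "w = rcis r \<phi>"
    using False by (simp_all add: r_def \<phi>_def rcis_cmod_Arg)
  have \<phi>: "- pi < \<phi>" "\<phi> \<le> pi" using Arg_bounded[of w] by (simp_all add: \<phi>_def)
  have "0 \<le> r * sin \<phi>" using assms(1) w by (simp add: sector_def)
  then have "0 \<le> sin \<phi>" using r by (simp add: zero_le_mult_iff)
  then have "0 \<le> \<phi>" using sin_gt_zero[of "- \<phi>"] \<phi> by force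
  moreover have "\<phi> \<le> \<alpha>"
  proof (rule ccontr)
    assume "\<not> \<phi> \<le> \<alpha>"
    then have "0 < sin (\<phi> - \<alpha>)" using assms \<phi> by (intro sin_gt_zero) auto
    moreover have "Im (w * cis (- \<alpha>)) = r * sin (\<phi> - \<alpha>)"
      by (simp add: w rcis_def sin_diff algebra_simps)
    moreover have "Im (w * cis (- \<alpha>)) \<le> 0"
      using assms(1) unfolding sector_def by (simp only: mem_Collect_eq)
    ultimately show False using mult_pos_pos[OF r] by force
  qed
  ultimately show ?thesis using r w by (intro that[of r \<phi>]) auto
qed

text \<open>The rays at angles \<open>0\<close> and \<open>\<alpha>\<close> are joined by a chord, on which the integrand is
  \<open>O(R\<^sup>-\<^sup>2)\<close>; on the real axis the integrand is real.\<close>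
lemma sector_ray_antiderivative_removable:
  fixes W :: "complex \<Rightarrow> complex" and p q \<alpha> :: real
  assumes \<alpha>: "0 < \<alpha>" "\<alpha> \<le> pi / 2" and pq: "0 \<le> p" "0 < q"
    and U: "open U" "sector \<alpha> \<subseteq> U" "W holomorphic_on U"
    and real: "\<And>x::real. 0 \<le> x \<Longrightarrow> Im (W (of_real x)) = 0"
    and bound: "\<And>w. w \<in> sector \<alpha> \<Longrightarrow> r0 \<le> cmod w \<Longrightarrow> cmod (W w) \<le> K"
    and zero: "W (of_real p) = 0"
  obtains H :: "real \<Rightarrow> real" and L where
    "\<And>t. 0 < t \<Longrightarrow> (H has_real_derivative
       Im (W (of_real t * cis \<alpha>) * cis \<alpha> *
         (1 / (of_real t * cis \<alpha> - of_real p) - 1 / (of_real t * cis \<alpha> + of_real q)))) (at t)"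
    "(H \<longlongrightarrow> L) (at_right 0)" "(H \<longlongrightarrow> L) at_top"
proof -
  let ?C = "sector \<alpha>"
  define e where "e = cis \<alpha>"
  \<comment> \<open>The zero of \<open>W\<close> at \<open>p\<close> cancels the simple pole there,
    so the difference quotient, completed by the derivative, stays holomorphic. The second factor
    comes from combining the two fractions; the pole at \<open>- q\<close> makes the whole decay
    like the inverse square of \<open>w\<close>.\<close>
  define h where "h = (\<lambda>w. (if w = of_real p then deriv W (of_real p)
      else (W w - W (of_real p)) / (w - of_real p)) * (of_real (p + q) / (w + of_real q)))"
  have ray: "of_real t * e \<in> ?C" if "0 \<le> t" for t
    using rcis_in_sector[of t \<alpha> \<alpha>] that \<alpha> by (simp add: rcis_def e_def)
  have axis: "of_real t \<in> ?C" if "0 \<le> t" for t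
    using rcis_in_sector[of t 0 \<alpha>] that \<alpha> by (simp add: rcis_def)
  have nq: "w + of_real q \<noteq> 0" if "w \<in> ?C" for w
  proof
    assume "w + of_real q = 0"
    then have "w = - of_real q" by (simp add: eq_neg_iff_add_eq_0)
    moreover have "0 < q * sin \<alpha>" using \<alpha> pq sin_gt_zero[of \<alpha>] by simp
    ultimately show False using that by (simp add: sector_def)
  qed
  have h_eq: "h w = W w * (1 / (w - of_real p) - 1 / (w + of_real q))"
    if "w + of_real q \<noteq> 0" "w \<noteq> of_real p" for w
  proof -
    have "1 / (w - of_real p) - 1 / (w + of_real q) = of_real (p + q) / ((w - of_real p) * (w + of_real q))"
      using that by (subst diff_frac_eq) auto
    then show ?thesis using that by (simp add: h_def zero)
  qed
  have holo: "h holomorphic_on (U - {- of_real q})"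
    unfolding h_def
  proof (intro holomorphic_on_mult)
    show "(\<lambda>w. if w = of_real p then deriv W (of_real p)
        else (W w - W (of_real p)) / (w - of_real p)) holomorphic_on (U - {- of_real q})"
      by (rule holomorphic_on_subset[OF pole_lemma_open[OF U(3,1)]]) auto
    show "(\<lambda>w. of_real (p + q) / (w + of_real q)) holomorphic_on (U - {- complex_of_real q})"
      by (auto intro!: holomorphic_intros simp: add_eq_0_iff2)
  qed
  have CU: "?C \<subseteq> U - {- of_real q}" using U nq[of "- of_real q"] by auto
  have openU: "open (U - {- complex_of_real q})" using U by (intro open_Diff) auto
  \<comment> \<open>A primitive on a convex set needs only continuity up to the boundary and
    differentiability in the interior; it replaces contour integrals by differences of values of
    \<open>g\<close>.\<close>
  obtain g where g: "\<And>x. x \<in> ?C \<Longrightarrow> (g has_field_derivative h x) (at x within ?C)"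
  proof (rule holomorphic_convex_primitive[OF convex_sector, of "{}" \<alpha> h])
    show "continuous_on ?C h"
      by (rule holomorphic_on_imp_continuous_on[OF holomorphic_on_subset[OF holo CU]])
    show "h field_differentiable at x" if "x \<in> interior ?C - {}" for x
      using holomorphic_on_imp_differentiable_at[OF holo openU] that CU interior_subset[of ?C] by auto
  qed auto
  have gcont: "continuous_on ?C g"
    using g by (rule DERIV_continuous_on)
  have path: "((\<lambda>t. Im (g (of_real t * a))) has_real_derivative Im (h (of_real t * a) * a)) (at t within T)"
    if T: "t \<in> T" "T \<subseteq> {0..}" and a: "\<And>t. 0 \<le> t \<Longrightarrow> of_real t * a \<in> ?C" for t T a
  proof -
    have "((\<lambda>t. of_real t * a) has_vector_derivative a) (at t within T)"
      by (auto intro!: derivative_eq_intros simp: has_vector_derivative_def scaleR_conv_of_real)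
    moreover have "(g has_field_derivative h (of_real t * a)) (at (of_real t * a) within (\<lambda>t. of_real t * a) ` T)"
      using T a by (intro DERIV_subset[OF g]) auto
    ultimately have "((g \<circ> (\<lambda>t. of_real t * a)) has_vector_derivative (a * h (of_real t * a))) (at t within T)"
      by (rule field_vector_diff_chain_within)
    from bounded_linear.has_vector_derivative[OF bounded_linear_Im this] show ?thesis
      by (simp add: has_real_derivative_iff_has_vector_derivative comp_def mult.commute)
  qed
  \<comment> \<open>On the axis \<open>h\<close> is real, so the imaginary part of \<open>g\<close>
    stays constant. The single point \<open>p\<close>, where \<open>h\<close> is given by its
    completed value, is an admissible exception for a continuous function.\<close>
  have const: "Im (g (of_real x)) = Im (g 0)" if "0 \<le> x" for x
  proof (rule has_derivative_zero_unique_strong_convex[of "{0::real..}" "{p}" "\<lambda>x. Im (g (of_real x))" 0])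
    show "continuous_on {0..} (\<lambda>x. Im (g (of_real x)))"
      by (intro continuous_intros continuous_on_compose2[OF gcont]) (auto intro: axis)
    show "((\<lambda>x. Im (g (of_real x))) has_derivative (\<lambda>h. 0)) (at x within {0..})"
      if x: "x \<in> {0..} - {p}" for x
    proof -
      have "((\<lambda>x. Im (g (of_real x * 1))) has_real_derivative Im (h (of_real x * 1) * 1)) (at x within {0..})"
        by (rule path) (use x axis in auto)
      moreover have "Im (h (of_real x)) = 0"
      proof -
        have "h (of_real x) = W (of_real x) * of_real (1 / (x - p) - 1 / (x + q))"
          using x pq by (subst h_eq) (auto simp flip: of_real_add)
        then show ?thesis using real[of x] x by simp
      qed
      ultimately show ?thesis by (simp add: has_field_derivative_def lambda_zero)
    qed
  qed (use that in auto)
  have chord: "cmod (g (of_real R * e) - g (of_real R))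
      \<le> K * (p + q) / ((R / 2 - p) * (R / 2 - q)) * (2 * R)"
    if R: "R > 2 * p + 2 * q + 2 * \<bar>r0\<bar>" for R
  proof -
    have R0: "0 < R" using R pq by simp
    let ?S = "closed_segment (of_real R) (of_real R * e)"
    have SC: "?S \<subseteq> ?C"
      using convex_sector ray[of R] axis[of R] R0 by (intro closed_segment_subset) auto
    have K0: "0 \<le> K"
      by (rule order_trans[OF norm_ge_zero bound[OF axis[of "\<bar>r0\<bar>"]]]) simp_all
    have far: "R / 2 \<le> cmod z" if z: "z \<in> ?S" for z
    proof -
      obtain u where u: "0 \<le> u" "u \<le> 1" "z = (1 - u) *\<^sub>R of_real R + u *\<^sub>R (of_real R * e)"
        using z by (auto simp: closed_segment_def)
      have cs: "0 \<le> cos \<alpha>" "0 \<le> sin \<alpha>"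
        using \<alpha> by (auto intro!: cos_ge_zero sin_ge_zero)
      \<comment> \<open>Up to a right angle, cosine and sine are nonnegative with sum at least 1.
        Hence the coordinates of a point of the chord add up to at least \<open>R\<close>, and the
        chord keeps distance \<open>R / 2\<close> from the origin.\<close>
      have "1 \<le> (cos \<alpha> + sin \<alpha>)\<^sup>2"
        using cs sin_cos_squared_add[of \<alpha>] by (simp add: power2_sum)
      then have "1 \<le> cos \<alpha> + sin \<alpha>"
        using cs by (intro power2_le_imp_le[of 1]) simp_all
      then have "u * 1 \<le> u * (cos \<alpha> + sin \<alpha>)" using u by (intro mult_left_mono)
      then have "R * 1 \<le> R * ((1 - u) + u * (cos \<alpha> + sin \<alpha>))"
        using R0 by (intro mult_left_mono) auto
      also have "\<dots> = Re z + Im z" by (simp add: u e_def algebra_simps)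
      also have "\<dots> \<le> 2 * cmod z" using complex_Re_le_cmod[of z] abs_Im_le_cmod[of z] by linarith
      finally show ?thesis by simp
    qed
    have "cmod (g (of_real R * e) - g (of_real R))
        \<le> (K * (p + q) / ((R / 2 - p) * (R / 2 - q))) * cmod (of_real R * e - of_real R)"
    proof (rule field_differentiable_bound[of ?S])
      show "(g has_field_derivative h z) (at z within ?S)" if "z \<in> ?S" for z
        using that SC by (intro DERIV_subset[OF g]) auto
      show "cmod (h z) \<le> K * (p + q) / ((R / 2 - p) * (R / 2 - q))" if z: "z \<in> ?S" for z
      proof -
        have zf: "R / 2 \<le> cmod z" by (rule far[OF z])
        then have zp: "z \<noteq> of_real p" using R pq by auto
        have d: "R / 2 - p \<le> cmod (z - of_real p)" "R / 2 - q \<le> cmod (z + of_real q)"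
          using zf norm_triangle_ineq2[of z "of_real p"] norm_diff_ineq[of z "of_real q"] pq by auto
        have "h z = W z * (of_real (p + q) / ((z - of_real p) * (z + of_real q)))"
        proof -
          have "1 / (z - of_real p) - 1 / (z + of_real q) = of_real (p + q) / ((z - of_real p) * (z + of_real q))"
            using zp nq[of z] z SC by (subst diff_frac_eq) auto
          then show ?thesis using h_eq[OF nq zp] z SC by auto
        qed
        then have "cmod (h z) = cmod (W z) * (p + q) / (cmod (z - of_real p) * cmod (z + of_real q))"
          using pq by (simp add: norm_mult norm_divide flip: of_real_add)
        also have "\<dots> \<le> K * (p + q) / ((R / 2 - p) * (R / 2 - q))"
          using bound[of z] z SC zf R pq d K0
          by (intro frac_le mult_mono mult_nonneg_nonneg mult_pos_pos) auto
        finally show ?thesis .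
      qed
    qed auto
    also have "\<dots> \<le> K * (p + q) / ((R / 2 - p) * (R / 2 - q)) * (2 * R)"
    proof (rule mult_left_mono)
      show "cmod (of_real R * e - of_real R) \<le> 2 * R"
        using norm_triangle_ineq4[of "of_real R * e" "of_real R"] R0 by (simp add: norm_mult e_def)
      show "0 \<le> K * (p + q) / ((R / 2 - p) * (R / 2 - q))"
        using K0 pq R by (intro divide_nonneg_nonneg mult_nonneg_nonneg) auto
    qed
    finally show ?thesis .
  qed
  show ?thesis
  \<comment> \<open>Along the ray the imaginary part of the primitive starts at
    \<open>Im (g 0)\<close>. At infinity it returns there: the chord leads back to the axis at a
    cost of order \<open>1 / R\<close>, and on the axis the value is constant.\<close>
  proof (rule that[of "\<lambda>t. Im (g (of_real t * e))" "Im (g 0)"])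
    show "((\<lambda>t. Im (g (of_real t * e))) has_real_derivative
       Im (W (of_real t * cis \<alpha>) * cis \<alpha> *
         (1 / (of_real t * cis \<alpha> - of_real p) - 1 / (of_real t * cis \<alpha> + of_real q)))) (at t)"
      if t: "0 < t" for t
    proof -
      have "Im (of_real t * e) > 0" using t \<alpha> sin_gt_zero[of \<alpha>] by (simp add: e_def)
      then have "of_real t * e \<noteq> of_real p" by (metis Im_complex_of_real less_irrefl)
      then have "h (of_real t * e) * e = W (of_real t * cis \<alpha>) * cis \<alpha> *
         (1 / (of_real t * cis \<alpha> - of_real p) - 1 / (of_real t * cis \<alpha> + of_real q))"
        using nq[OF ray[of t]] t by (subst h_eq) (auto simp: e_def)
      moreover have "((\<lambda>t. Im (g (of_real t * e))) has_real_derivative Im (h (of_real t * e) * e)) (at t within {0<..})"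
        by (rule path) (use t ray in auto)
      ultimately show ?thesis using t by (simp add: at_within_open[of t "{0<..}"])
    qed
    have "continuous_on {0..} (\<lambda>t. Im (g (of_real t * e)))"
      by (intro continuous_intros continuous_on_compose2[OF gcont]) (auto intro: ray)
    then have "((\<lambda>t. Im (g (of_real t * e))) \<longlongrightarrow> Im (g (of_real 0 * e))) (at 0 within {0..})"
      unfolding continuous_on_def by (rule bspec) simp
    then show "((\<lambda>t. Im (g (of_real t * e))) \<longlongrightarrow> Im (g 0)) (at_right 0)"
      by (auto intro: tendsto_within_subset)
    have lim: "((\<lambda>R. K * (p + q) / ((R / 2 - p) * (R / 2 - q)) * (2 * R)) \<longlongrightarrow> 0) at_top"
      by real_asymp
    have "((\<lambda>R. Im (g (of_real R * e)) - Im (g 0)) \<longlongrightarrow> 0) at_top"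
    proof (rule Lim_null_comparison[OF _ lim])
      show "\<forall>\<^sub>F R in at_top. norm (Im (g (of_real R * e)) - Im (g 0))
          \<le> K * (p + q) / ((R / 2 - p) * (R / 2 - q)) * (2 * R)"
        using eventually_gt_at_top[of "2 * p + 2 * q + 2 * \<bar>r0\<bar>"]
      proof eventually_elim
        case (elim R)
        have "Im (g (of_real R * e)) - Im (g 0) = Im (g (of_real R * e) - g (of_real R))"
          using const[of R] elim pq by simp
        then have "\<bar>Im (g (of_real R * e)) - Im (g 0)\<bar> \<le> cmod (g (of_real R * e) - g (of_real R))"
          using abs_Im_le_cmod by metis
        also note chord[OF elim]
        finally show ?case by simp
      qed
    qed
    then show "((\<lambda>t. Im (g (of_real t * e))) \<longlongrightarrow> Im (g 0)) at_top"
      by (simp add: LIM_zero_iff)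
  qed
qed

text \<open>A nonzero constant cannot absorb the pole at \<open>p\<close>, so this case is
  integrated explicitly: each fraction contributes a Poisson kernel in \<open>t\<close>, with an
  arctangent as antiderivative. The two arctangents cancel at 0 and tend to \<open>pi / 2\<close>
  each.\<close>

lemma poisson_ray_antiderivative:
  fixes p q \<alpha> :: real
  assumes \<alpha>: "0 < \<alpha>" "\<alpha> \<le> pi / 2" and pq: "0 < p" "0 < q"
  obtains H :: "real \<Rightarrow> real" where
    "\<And>t. 0 < t \<Longrightarrow> (H has_real_derivative
       - Im (cis \<alpha> * (1 / (of_real t * cis \<alpha> - of_real p) - 1 / (of_real t * cis \<alpha> + of_real q)))) (at t)"
    "(H \<longlongrightarrow> 0) (at_right 0)" "(H \<longlongrightarrow> pi) at_top"
proof -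
  define s c where "s = sin \<alpha>" and "c = cos \<alpha>"
  have s: "0 < s" using \<alpha> sin_gt_zero[of \<alpha>] by (simp add: s_def)
  have sc: "c\<^sup>2 = 1 - s\<^sup>2" by (simp add: s_def c_def sin_squared_eq)
  let ?H = "\<lambda>t. arctan ((t - p * c) / (p * s)) + arctan ((t + q * c) / (q * s))"
  have im: "Im (cis \<alpha> / (of_real t * cis \<alpha> + of_real a)) = a * s / ((t * c + a)\<^sup>2 + (t * s)\<^sup>2)" for t a
    by (simp add: Im_divide s_def c_def algebra_simps)
  have one: "((\<lambda>t. arctan ((t + a * c) / (a * s))) has_real_derivative a * s / ((t * c + a)\<^sup>2 + (t * s)\<^sup>2)) (at t)"
    if "a \<noteq> 0" for a t
  proof -
    have sq: "(t * c + a)\<^sup>2 + (t * s)\<^sup>2 = (a * s)\<^sup>2 + (t + a * c)\<^sup>2"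
      using sc by algebra
    have pos: "0 < (a * s)\<^sup>2 + (t + a * c)\<^sup>2"
      using that s by (intro add_pos_nonneg) auto
    have "((\<lambda>t. arctan ((t + a * c) / (a * s))) has_real_derivative
        inverse (1 + ((t + a * c) / (a * s))\<^sup>2) * (1 / (a * s))) (at t)"
      using that s by (auto intro!: derivative_eq_intros)
    moreover have "inverse (1 + ((t + a * c) / (a * s))\<^sup>2) * (1 / (a * s)) = a * s / ((a * s)\<^sup>2 + (t + a * c)\<^sup>2)"
      using that s pos by (simp add: field_simps power2_eq_square)
    ultimately show ?thesis unfolding sq by simp
  qed
  \<comment> \<open>The fraction with \<open>p\<close> is the same kernel with parameter
    \<open>- p\<close>, once a sign is pulled out of the arctangent.\<close>
  have eqn: "((t - p * c) / (p * s)) = - ((t + - p * c) / (- p * s))" for t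
    by simp
  show ?thesis
  proof (rule that[of ?H])
    show "(?H has_real_derivative
       - Im (cis \<alpha> * (1 / (of_real t * cis \<alpha> - of_real p) - 1 / (of_real t * cis \<alpha> + of_real q)))) (at t)" for t
    proof -
      have "- Im (cis \<alpha> * (1 / (of_real t * cis \<alpha> - of_real p) - 1 / (of_real t * cis \<alpha> + of_real q)))
          = - (- p * s / ((t * c + - p)\<^sup>2 + (t * s)\<^sup>2)) + q * s / ((t * c + q)\<^sup>2 + (t * s)\<^sup>2)"
        using im[of t "- p"] im[of t q] by (simp add: right_diff_distrib)
      moreover have "(?H has_real_derivative \<dots>) (at t)"
        unfolding eqn arctan_minus using pq by (intro DERIV_add DERIV_minus one) auto
      ultimately show ?thesis by simp
    qed
    have "((\<lambda>t. ?H t) \<longlongrightarrow> ?H 0) (at_right 0)"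
      using pq s by (intro tendsto_intros) auto
    then show "(?H \<longlongrightarrow> 0) (at_right 0)"
      using pq s by (simp add: arctan_minus)
    have "filterlim (\<lambda>t::real. (t + d) / k) at_top at_top" if "0 < k" for d k :: real
      using that by real_asymp
    from this[of "p * s" "- p * c"] this[of "q * s" "q * c"] have "(?H \<longlongrightarrow> pi / 2 + pi / 2) at_top"
      using pq s by (intro tendsto_add filterlim_compose[OF tendsto_arctan_at_top]) auto
    then show "(?H \<longlongrightarrow> pi) at_top" by simp
  qed
qed

text \<open>Splitting \<open>V\<close> into \<open>V - V p\<close> and the constant
  \<open>V p\<close> separates the two previous cases. The first part has equal limits at both ends;
  the second, which is real, contributes \<open>pi * V p\<close>, half of a full residue because the
  pole lies on the boundary.\<close>

lemma sector_ray_antiderivative: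
  fixes V :: "complex \<Rightarrow> complex" and p q \<alpha> :: real
  assumes \<alpha>: "0 < \<alpha>" "\<alpha> \<le> pi / 2" and pq: "0 \<le> p" "0 < q"
    and U: "open U" "sector \<alpha> \<subseteq> U" "V holomorphic_on U"
    and real: "\<And>x::real. 0 \<le> x \<Longrightarrow> Im (V (of_real x)) = 0"
    and bound: "\<And>w. w \<in> sector \<alpha> \<Longrightarrow> r0 \<le> cmod w \<Longrightarrow> cmod (V w) \<le> K"
    and zero: "p = 0 \<Longrightarrow> V 0 = 0"
  obtains H :: "real \<Rightarrow> real" and L where
    "\<And>t. 0 < t \<Longrightarrow> (H has_real_derivative
       - Im (V (of_real t * cis \<alpha>) * cis \<alpha> *
         (1 / (of_real t * cis \<alpha> - of_real p) - 1 / (of_real t * cis \<alpha> + of_real q)))) (at t)"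
    "(H \<longlongrightarrow> L) (at_right 0)" "(H \<longlongrightarrow> L + pi * Re (V (of_real p))) at_top"
proof -
  define a where "a = Re (V (of_real p))"
  have a: "V (of_real p) = of_real a"
    using real[OF pq(1)] by (simp add: a_def complex_eq_iff)
  obtain H1 L where H1: "\<And>t. 0 < t \<Longrightarrow> (H1 has_real_derivative
       Im ((V (of_real t * cis \<alpha>) - of_real a) * cis \<alpha> *
         (1 / (of_real t * cis \<alpha> - of_real p) - 1 / (of_real t * cis \<alpha> + of_real q)))) (at t)"
    "(H1 \<longlongrightarrow> L) (at_right 0)" "(H1 \<longlongrightarrow> L) at_top"
  proof (rule sector_ray_antiderivative_removable[OF \<alpha> pq U(1,2), of "\<lambda>w. V w - of_real a" r0 "K + \<bar>a\<bar>"])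
    show "(\<lambda>w. V w - of_real a) holomorphic_on U" by (intro holomorphic_intros U)
    show "cmod (V w - of_real a) \<le> K + \<bar>a\<bar>" if "w \<in> sector \<alpha>" "r0 \<le> cmod w" for w
      using bound[OF that] norm_triangle_ineq4[of "V w" "of_real a"] by simp
  qed (use real a in auto)
  obtain H2 where H2: "\<And>t. 0 < t \<Longrightarrow> (H2 has_real_derivative
       - Im (of_real a * (cis \<alpha> *
         (1 / (of_real t * cis \<alpha> - of_real p) - 1 / (of_real t * cis \<alpha> + of_real q))))) (at t)"
    "(H2 \<longlongrightarrow> 0) (at_right 0)" "(H2 \<longlongrightarrow> pi * a) at_top"
  proof (cases "p = 0")
    case True
    \<comment> \<open>A pole at the vertex is allowed only together with \<open>V 0 = 0\<close>,
      which leaves no constant part.\<close>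
    then have "a = 0" using zero a by simp
    then show ?thesis by (intro that[of "\<lambda>_. 0"]) auto
  next
    case False
    then have "0 < p" using pq by simp
    from poisson_ray_antiderivative[OF \<alpha> this pq(2)] obtain H where
      H: "\<And>t. 0 < t \<Longrightarrow> (H has_real_derivative
       - Im (cis \<alpha> * (1 / (of_real t * cis \<alpha> - of_real p) - 1 / (of_real t * cis \<alpha> + of_real q)))) (at t)"
      "(H \<longlongrightarrow> 0) (at_right 0)" "(H \<longlongrightarrow> pi) at_top"
      by blast
    show ?thesis
    proof (rule that[of "\<lambda>t. a * H t"])
      show "((\<lambda>t. a * H t) has_real_derivative
       - Im (of_real a * (cis \<alpha> *
         (1 / (of_real t * cis \<alpha> - of_real p) - 1 / (of_real t * cis \<alpha> + of_real q))))) (at t)"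
        if "0 < t" for t
        using DERIV_cmult[OF H(1)[OF that], of a]
        by (simp only: times_complex.sel Re_complex_of_real Im_complex_of_real mult_zero_left add_0_right mult_minus_right)
      show "((\<lambda>t. a * H t) \<longlongrightarrow> 0) (at_right 0)"
        using tendsto_mult_left[OF H(2), of a] by simp
      show "((\<lambda>t. a * H t) \<longlongrightarrow> pi * a) at_top"
        using tendsto_mult_left[OF H(3), of a] by (simp add: mult.commute)
    qed
  qed
  show ?thesis
  proof (rule that[of "\<lambda>t. - H1 t + H2 t" "- L"])
    show "((\<lambda>t. - H1 t + H2 t) has_real_derivative - Im (V (of_real t * cis \<alpha>) * cis \<alpha> *
         (1 / (of_real t * cis \<alpha> - of_real p) - 1 / (of_real t * cis \<alpha> + of_real q)))) (at t)"
      (is "(_ has_real_derivative - Im (?v * cis \<alpha> * ?X)) _") if t: "0 < t" for t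
    proof -
      have "?v * cis \<alpha> * ?X = (?v - of_real a) * cis \<alpha> * ?X + of_real a * (cis \<alpha> * ?X)"
        by (simp only: left_diff_distrib mult.assoc diff_add_cancel)
      then have eq: "- Im (?v * cis \<alpha> * ?X) =
          - Im ((?v - of_real a) * cis \<alpha> * ?X) + - Im (of_real a * (cis \<alpha> * ?X))"
        by (simp only: plus_complex.sel minus_add_distrib)
      show ?thesis
        unfolding eq by (intro DERIV_add DERIV_minus H1(1) H2(1) t)
    qed
    show "((\<lambda>t. - H1 t + H2 t) \<longlongrightarrow> - L) (at_right 0)"
      using tendsto_add[OF tendsto_minus[OF H1(2)] H2(2)] by simp
    show "((\<lambda>t. - H1 t + H2 t) \<longlongrightarrow> - L + pi * Re (V (of_real p))) at_top"
      using tendsto_add[OF tendsto_minus[OF H1(3)] H2(3)] by (simp add: a_def)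
  qed
qed

section \<open>A Stieltjes transform\<close>

text \<open>With \<open>w - v\<close> as a further factor in the denominator this is
  \<open>m w\<^bsup>m-1\<^esup> / (w\<^bsup>m\<^esup> - v\<^bsup>m\<^esup>)\<close>: the pole at \<open>w = v\<close> is split off.\<close>
definition root_kernel :: "nat \<Rightarrow> real \<Rightarrow> complex \<Rightarrow> complex" where
  "root_kernel m v w = of_nat m * w ^ (m - 1) / (\<Sum>i<m. of_real v ^ (m - Suc i) * w ^ i)"

text \<open>Away from \<open>v\<close> the sum is \<open>(w^m - v^m) / (w - v)\<close>. A point of
  the sector with \<open>w^m = v^m\<close> has modulus \<open>v\<close> and, since
  \<open>m * \<phi>\<close> stays in \<open>[0, pi]\<close>, argument 0, so it is \<open>v\<close>
  itself; there all \<open>m\<close> terms equal \<open>v^(m-1)\<close>.\<close>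

lemma root_kernel_denominator_nonzero:
  assumes m: "2 \<le> m" and v: "0 < v" and w: "w \<in> sector (pi / real m)"
  shows "(\<Sum>i<m. of_real v ^ (m - Suc i) * w ^ i) \<noteq> (0 :: complex)"
proof (cases "w = of_real v")
  case True
  have "(\<Sum>i<m. of_real v ^ (m - Suc i) * w ^ i) = (\<Sum>i<m. complex_of_real v ^ (m - 1))"
    unfolding True by (intro sum.cong refl) (simp flip: power_add)
  then show ?thesis using m v by simp
next
  case False
  have "pi / real m < pi" using m by (simp add: divide_less_eq)
  then obtain r \<phi> where r: "0 \<le> r" "0 \<le> \<phi>" "\<phi> \<le> pi / real m" "w = rcis r \<phi>"
    using sector_cases[OF w] m by auto
  have "w ^ m \<noteq> of_real v ^ m"
  proof
    assume eq: "w ^ m = of_real v ^ m"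
    then have "cmod (w ^ m) = cmod (of_real v ^ m)" by simp
    then have "r ^ m = v ^ m" using r v by (simp add: norm_power)
    then have rv: "r = v" by (rule power_eq_imp_eq_base) (use r v m in auto)
    have "Re (w ^ m) = v ^ m" unfolding eq by (simp flip: of_real_power)
    then have "v ^ m * cos (real m * \<phi>) = v ^ m" unfolding r(4) rv DeMoivre2 by simp
    then have cos_eq: "cos (real m * \<phi>) = cos 0" using v by simp
    have "real m * \<phi> = 0"
    proof (rule cos_inj_pi[OF _ _ _ _ cos_eq])
      show "real m * \<phi> \<le> pi" using r(3) m by (simp add: le_divide_eq mult.commute)
    qed (use r(2) in auto)
    then have "w = of_real v" using r rv m by (simp add: rcis_def)
    then show False using False by simp
  qed
  then show ?thesis using power_diff_sumr2[of w m "of_real v"] by auto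
qed

lemma root_kernel_mult:
  assumes "(\<Sum>i<m. of_real v ^ (m - Suc i) * w ^ i) \<noteq> (0 :: complex)"
  shows "root_kernel m v w * (w ^ m - of_real v ^ m) = of_nat m * w ^ (m - 1) * (w - of_real v)"
  using assms by (simp add: root_kernel_def power_diff_sumr2 mult.commute)

lemma root_kernel_real: "Im (root_kernel m v (of_real x)) = 0"
proof -
  have "root_kernel m v (of_real x) = of_real (real m * x ^ (m - 1) / (\<Sum>i<m. v ^ (m - Suc i) * x ^ i))"
    by (simp add: root_kernel_def)
  then show ?thesis by simp
qed

text \<open>This value is the residue of \<open>m w^(m-1) / (w^m - v^m)\<close>, a logarithmic
  derivative, at the simple zero \<open>v\<close> of its denominator.\<close>

lemma root_kernel_self:
  assumes "2 \<le> m" "0 < v"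
  shows "root_kernel m v (of_real v) = 1"
proof -
  have "(\<Sum>i<m. of_real v ^ (m - Suc i) * of_real v ^ i) = (\<Sum>i<m. complex_of_real v ^ (m - 1))"
    by (intro sum.cong refl) (simp flip: power_add)
  then show ?thesis using assms by (simp add: root_kernel_def)
qed

text \<open>The weight of a second pole at \<open>p\<close> on the axis, needed when
  \<open>c\<close> is not positive and \<open>p = - c\<close>.\<close>

lemma Re_root_kernel_axis:
  assumes "2 \<le> m" "0 \<le> p" "p < v"
  shows "Re (root_kernel m v (of_real p)) = real m * p ^ (m - 1) * (v - p) / (v ^ m - p ^ m)"
proof -
  have S: "v ^ m - p ^ m = (v - p) * (\<Sum>i<m. v ^ (m - Suc i) * p ^ i)"
    using power_diff_sumr2[of p m v] by (simp add: algebra_simps)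
  have "root_kernel m v (of_real p) = of_real (real m * p ^ (m - 1) / (\<Sum>i<m. v ^ (m - Suc i) * p ^ i))"
    by (simp add: root_kernel_def)
  then show ?thesis unfolding S Re_complex_of_real using assms by simp
qed

text \<open>For \<open>r = cmod w\<close> at least \<open>2 v\<close>, the difference
  \<open>w^m - v^m\<close> keeps at least half of \<open>r^m\<close>, while \<open>w - v\<close> is
  at most \<open>3 r / 2\<close>; the quotient gives the constant \<open>3 m\<close>.\<close>

lemma root_kernel_bounded:
  assumes m: "2 \<le> m" and v: "0 < v" and w: "w \<in> sector (pi / real m)" and far: "2 * v \<le> cmod w"
  shows "cmod (root_kernel m v w) \<le> 3 * real m"
proof -
  define r where "r = cmod w"
  have r: "0 < r" using far v unfolding r_def by linarith
  have "v ^ m \<le> (r / 2) ^ m" using far v by (intro power_mono) (auto simp: r_def)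
  also have "\<dots> \<le> r ^ m / 2"
    using r m power_increasing[of 1 m "2::real"] by (simp add: power_divide field_simps)
  finally have lower: "r ^ m / 2 \<le> cmod (w ^ m - of_real v ^ m)"
    using norm_triangle_ineq2[of "w ^ m" "of_real v ^ m"] v by (simp add: norm_power r_def)
  have upper: "cmod (w - of_real v) \<le> 3 / 2 * r"
    using norm_triangle_ineq4[of w "of_real v"] far v by (simp add: r_def)
  have "cmod (root_kernel m v w) * (r ^ m / 2) \<le> cmod (root_kernel m v w) * cmod (w ^ m - of_real v ^ m)"
    by (intro mult_left_mono lower) simp
  also have "\<dots> = real m * r ^ (m - 1) * cmod (w - of_real v)"
    using arg_cong[OF root_kernel_mult[OF root_kernel_denominator_nonzero[OF m v w]], of cmod]
    by (simp add: norm_mult norm_power r_def)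
  also have "\<dots> \<le> real m * r ^ (m - 1) * (3 / 2 * r)"
    using r by (intro mult_left_mono upper) simp
  also have "\<dots> = 3 * real m * (r ^ m / 2)"
    using m power_minus_mult[of m r] by simp
  finally show ?thesis by (rule mult_right_le_imp_le) (use r in simp)
qed

text \<open>The angle \<open>pi / m\<close> is chosen so that \<open>w^m = - t^m\<close>. On the ray
  \<open>w^m - v^m\<close> is therefore real, and the kernel times \<open>cis (pi / m)\<close>
  becomes a real multiple of \<open>w - v\<close>, which later cancels the pole factor
  \<open>1 / (w - v)\<close>.\<close>

lemma root_kernel_ray:
  assumes m: "2 \<le> m" and v: "0 < v" and t: "0 < t"
  defines "w \<equiv> of_real t * cis (pi / real m)"
  shows "root_kernel m v w * cis (pi / real m) = of_real (real m * t ^ (m - 1) / (t ^ m + v ^ m)) * (w - of_real v)"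
proof -
  have w: "w \<in> sector (pi / real m)"
    using rcis_in_sector[of t "pi / m" "pi / m"] m t by (simp add: w_def rcis_def divide_le_eq)
  have "cis (pi / real m) ^ m = cis pi"
  proof -
    have "real m * (pi / real m) = pi" using m by simp
    then show ?thesis by (simp only: Complex.DeMoivre)
  qed
  then have "w ^ m = of_real (t ^ m) * cis pi"
    by (simp add: w_def power_mult_distrib)
  then have wm: "w ^ m = - of_real (t ^ m)" by simp
  have wm1: "w ^ (m - 1) * w = w ^ m" using m power_minus_mult[of m w] by simp
  have tm1: "t ^ (m - 1) * t = t ^ m" using m power_minus_mult[of m t] by simp
  have "t ^ m + v ^ m \<noteq> 0" using t v add_pos_pos[of "t ^ m" "v ^ m"] by simp
  then have pos: "complex_of_real (t ^ m + v ^ m) \<noteq> 0" unfolding of_real_eq_0_iff .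
  \<comment> \<open>Multiplying by \<open>t\<close> completes \<open>cis (pi / m)\<close> to
    \<open>w\<close>, hence \<open>w^(m-1)\<close> to \<open>w^m\<close>, and the other factor is
    exactly \<open>w^m - v^m\<close>.\<close>
  have "root_kernel m v w * cis (pi / real m) * of_real t * - of_real (t ^ m + v ^ m)
      = (root_kernel m v w * (w ^ m - of_real v ^ m)) * w"
    unfolding wm by (simp add: w_def)
  also have "\<dots> = of_nat m * (w ^ (m - 1) * w) * (w - of_real v)"
    unfolding root_kernel_mult[OF root_kernel_denominator_nonzero[OF m v w]] by (simp only: ac_simps)
  also have "\<dots> = - (of_real (real m * t ^ (m - 1)) * (w - of_real v)) * of_real t"
    unfolding wm1 wm by (simp flip: tm1)
  finally have eq: "root_kernel m v w * cis (pi / real m) * of_real t * - of_real (t ^ m + v ^ m)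
      = - (of_real (real m * t ^ (m - 1)) * (w - of_real v)) * of_real t" .
  have "x * s = y" if "x * of_real t * - s = - y * of_real t" for x y s :: complex
  proof -
    have "of_real t * (x * s - y) = 0" using that by (simp add: algebra_simps)
    then show ?thesis using t by simp
  qed
  from this[OF eq]
  have "root_kernel m v w * cis (pi / real m) * of_real (t ^ m + v ^ m)
      = of_real (real m * t ^ (m - 1)) * (w - of_real v)" .
  then show ?thesis using pos by (simp only: of_real_divide times_divide_eq_left eq_divide_eq) simp
qed

text \<open>The difference \<open>1 / (w - v) - 1 / (w + c)\<close> equals
  \<open>(v + c) / ((w - v) (w + c))\<close>, so on the ray the integrand is a real factor times the
  imaginary part of \<open>1 / (w + c)\<close>. For \<open>c > 0\<close> the pole \<open>- c\<close>
  is off the sector; otherwise it lies on the axis and its weight is subtracted.\<close>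

lemma rational_ray_antiderivative:
  fixes m :: nat and v c :: real
  assumes m: "2 \<le> m" and v: "0 < v" and vc: "0 < v + c"
  obtains H :: "real \<Rightarrow> real" and L where
    "\<And>t. 0 < t \<Longrightarrow> (H has_real_derivative
       real m * t ^ (m - 1) / (t ^ m + v ^ m) *
       (t * sin (pi / m) / (c\<^sup>2 + 2 * c * t * cos (pi / m) + t\<^sup>2))) (at t)"
    "(H \<longlongrightarrow> L) (at_right 0)"
    "(H \<longlongrightarrow> L + pi * (1 / (v + c) -
       (if c < 0 then real m * (- c) ^ (m - 1) / (v ^ m - (- c) ^ m) else 0))) at_top"
proof -
  define \<alpha> where "\<alpha> = pi / real m"
  have \<alpha>: "0 < \<alpha>" "\<alpha> \<le> pi / 2" using m by (auto simp: \<alpha>_def field_simps)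
  let ?V = "root_kernel m v"
  let ?w = "\<lambda>t::real. of_real t * cis \<alpha>"
  define U where "U = {w::complex. (\<Sum>i<m. of_real v ^ (m - Suc i) * w ^ i) \<noteq> 0}"
  have "open U"
    unfolding U_def by (intro open_Collect_neq continuous_intros)
  moreover have "sector \<alpha> \<subseteq> U"
    using root_kernel_denominator_nonzero[OF m v] by (auto simp: U_def \<alpha>_def)
  ultimately have U: "open U" "sector \<alpha> \<subseteq> U" .
  have "?V = (\<lambda>w. of_nat m * w ^ (m - 1) / (\<Sum>i<m. of_real v ^ (m - Suc i) * w ^ i))"
    by (simp add: fun_eq_iff root_kernel_def)
  moreover have "\<dots> holomorphic_on U"
    by (intro holomorphic_intros) (simp add: U_def)
  ultimately have holo: "?V holomorphic_on U" by simp
  have V0: "?V 0 = 0" using m by (simp add: root_kernel_def)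
  have main: "\<exists>H L. (\<forall>t>0. (H has_real_derivative - Im (?V (?w t) * cis \<alpha> *
         (1 / (?w t - of_real p) - 1 / (?w t + of_real q)))) (at t)) \<and>
      (H \<longlongrightarrow> L) (at_right 0) \<and> (H \<longlongrightarrow> L + pi * Re (?V (of_real p))) at_top"
    if pq: "0 \<le> p" "0 < q" for p q
  proof -
    have bound: "cmod (?V w) \<le> 3 * real m" if "w \<in> sector \<alpha>" "2 * v \<le> cmod w" for w
      using root_kernel_bounded[OF m v] that by (simp add: \<alpha>_def)
    show ?thesis
    proof (rule sector_ray_antiderivative[OF \<alpha> pq U holo root_kernel_real bound V0])
      fix H L
      assume "\<And>t. 0 < t \<Longrightarrow> (H has_real_derivative - Im (?V (?w t) * cis \<alpha> *
         (1 / (?w t - of_real p) - 1 / (?w t + of_real q)))) (at t)"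
        "(H \<longlongrightarrow> L) (at_right 0)" "(H \<longlongrightarrow> L + pi * Re (?V (of_real p))) at_top"
      then show ?thesis by (intro exI[of _ H] exI[of _ L] conjI allI impI)
    qed
  qed
  have ray_value: "- Im (?V (?w t) * cis \<alpha> * (1 / (?w t - of_real v) - 1 / (?w t + of_real c))) / (v + c) =
      real m * t ^ (m - 1) / (t ^ m + v ^ m) * (t * sin \<alpha> / (c\<^sup>2 + 2 * c * t * cos \<alpha> + t\<^sup>2))"
    if t: "0 < t" for t
  proof -
    have "Im (?w t) > 0" using t \<alpha> sin_gt_zero[of \<alpha>] by simp
    then have nz: "?w t - of_real v \<noteq> 0" "?w t + of_real c \<noteq> 0" by (auto simp: complex_eq_iff)
    have "?V (?w t) * cis \<alpha> * (1 / (?w t - of_real v) - 1 / (?w t + of_real c)) =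
        of_real (real m * t ^ (m - 1) / (t ^ m + v ^ m)) * ((?w t - of_real v) * (1 / (?w t - of_real v) - 1 / (?w t + of_real c)))"
      using root_kernel_ray[OF m v t] by (simp add: \<alpha>_def mult.assoc)
    also have "(?w t - of_real v) * (1 / (?w t - of_real v) - 1 / (?w t + of_real c)) = of_real (v + c) * (1 / (?w t + of_real c))"
      using nz by (simp add: diff_frac_eq)
    finally have "?V (?w t) * cis \<alpha> * (1 / (?w t - of_real v) - 1 / (?w t + of_real c)) =
        of_real (real m * t ^ (m - 1) / (t ^ m + v ^ m) * (v + c)) * (1 / (?w t + of_real c))"
      by (simp only: of_real_mult mult.assoc)
    then have "- Im (?V (?w t) * cis \<alpha> * (1 / (?w t - of_real v) - 1 / (?w t + of_real c))) =
        real m * t ^ (m - 1) / (t ^ m + v ^ m) * (v + c) * - Im (1 / (?w t + of_real c))"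
      by (simp only: times_complex.sel Re_complex_of_real Im_complex_of_real mult_zero_left add_0_right mult_minus_right)
    also have "- Im (1 / (?w t + of_real c)) = t * sin \<alpha> / ((t * cos \<alpha> + c)\<^sup>2 + (t * sin \<alpha>)\<^sup>2)"
      by (simp add: Im_divide)
    also have "(t * cos \<alpha> + c)\<^sup>2 + (t * sin \<alpha>)\<^sup>2 = c\<^sup>2 + 2 * c * t * cos \<alpha> + t\<^sup>2"
      using sin_cos_squared_add[of \<alpha>] by algebra
    finally show ?thesis using vc by simp
  qed
  show ?thesis
  proof (cases "0 < c")
    case True
    obtain H L where H: "\<And>t. 0 < t \<Longrightarrow> (H has_real_derivative - Im (?V (?w t) * cis \<alpha> *
         (1 / (?w t - of_real v) - 1 / (?w t + of_real c)))) (at t)"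
      "(H \<longlongrightarrow> L) (at_right 0)" "(H \<longlongrightarrow> L + pi * Re (?V (of_real v))) at_top"
      using main[of v c] v True by auto
    show ?thesis
    proof (rule that[of "\<lambda>t. H t / (v + c)" "L / (v + c)"])
      show "((\<lambda>t. H t / (v + c)) has_real_derivative
       real m * t ^ (m - 1) / (t ^ m + v ^ m) *
       (t * sin (pi / m) / (c\<^sup>2 + 2 * c * t * cos (pi / m) + t\<^sup>2))) (at t)" if "0 < t" for t
        using DERIV_cdivide[OF H(1)[OF that], of "v + c"] ray_value[OF that] by (simp only: \<alpha>_def)
      show "((\<lambda>t. H t / (v + c)) \<longlongrightarrow> L / (v + c)) (at_right 0)"
        using H(2) vc by (intro tendsto_intros) auto
      have "((\<lambda>t. H t / (v + c)) \<longlongrightarrow> (L + pi * Re (?V (of_real v))) / (v + c)) at_top"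
        using H(3) vc by (intro tendsto_intros) auto
      then show "((\<lambda>t. H t / (v + c)) \<longlongrightarrow> L / (v + c) + pi * (1 / (v + c) -
       (if c < 0 then real m * (- c) ^ (m - 1) / (v ^ m - (- c) ^ m) else 0))) at_top"
        using True root_kernel_self[OF m v] by (simp add: add_divide_distrib)
    qed
  next
    case False
    define p where "p = - c"
    have p: "0 \<le> p" "p < v" "c = - p" using False vc by (simp_all add: p_def)
    \<comment> \<open>With \<open>- c\<close> in the sector, the poles \<open>v\<close> and
      \<open>p\<close> are each compared with an auxiliary pole at -1, which cancels in the
      difference.\<close>
    obtain H1 L1 where H1: "\<And>t. 0 < t \<Longrightarrow> (H1 has_real_derivative - Im (?V (?w t) * cis \<alpha> *
         (1 / (?w t - of_real v) - 1 / (?w t + of_real 1)))) (at t)"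
      "(H1 \<longlongrightarrow> L1) (at_right 0)" "(H1 \<longlongrightarrow> L1 + pi * Re (?V (of_real v))) at_top"
      using main[of v 1] v by auto
    obtain H2 L2 where H2: "\<And>t. 0 < t \<Longrightarrow> (H2 has_real_derivative - Im (?V (?w t) * cis \<alpha> *
         (1 / (?w t - of_real p) - 1 / (?w t + of_real 1)))) (at t)"
      "(H2 \<longlongrightarrow> L2) (at_right 0)" "(H2 \<longlongrightarrow> L2 + pi * Re (?V (of_real p))) at_top"
      using main[of p 1] p by auto
    show ?thesis
    proof (rule that[of "\<lambda>t. (H1 t - H2 t) / (v + c)" "(L1 - L2) / (v + c)"])
      show "((\<lambda>t. (H1 t - H2 t) / (v + c)) has_real_derivative
       real m * t ^ (m - 1) / (t ^ m + v ^ m) *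
       (t * sin (pi / m) / (c\<^sup>2 + 2 * c * t * cos (pi / m) + t\<^sup>2))) (at t)" if t: "0 < t" for t
      proof -
        have "?V (?w t) * cis \<alpha> * (1 / (?w t - of_real v) - 1 / (?w t + of_real c)) =
            ?V (?w t) * cis \<alpha> * (1 / (?w t - of_real v) - 1 / (?w t + of_real 1)) -
            ?V (?w t) * cis \<alpha> * (1 / (?w t - of_real p) - 1 / (?w t + of_real 1))"
          unfolding right_diff_distrib[symmetric] p(3) by simp
        then have "- Im (?V (?w t) * cis \<alpha> * (1 / (?w t - of_real v) - 1 / (?w t + of_real c))) =
            - Im (?V (?w t) * cis \<alpha> * (1 / (?w t - of_real v) - 1 / (?w t + of_real 1))) -
            - Im (?V (?w t) * cis \<alpha> * (1 / (?w t - of_real p) - 1 / (?w t + of_real 1)))"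
          by (simp only: minus_complex.sel)
        from DERIV_cdivide[OF DERIV_diff[OF H1(1)[OF t] H2(1)[OF t], folded this], of "v + c"] ray_value[OF t]
        show ?thesis by (simp only: \<alpha>_def)
      qed
      show "((\<lambda>t. (H1 t - H2 t) / (v + c)) \<longlongrightarrow> (L1 - L2) / (v + c)) (at_right 0)"
        using H1(2) H2(2) vc by (intro tendsto_intros) auto
      have "((\<lambda>t. (H1 t - H2 t) / (v + c)) \<longlongrightarrow>
          ((L1 + pi * Re (?V (of_real v))) - (L2 + pi * Re (?V (of_real p)))) / (v + c)) at_top"
        using H1(3) H2(3) vc by (intro tendsto_intros) auto
      moreover have "((L1 + pi * Re (?V (of_real v))) - (L2 + pi * Re (?V (of_real p)))) / (v + c) =
          (L1 - L2) / (v + c) + pi * (1 / (v + c) -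
          (if c < 0 then real m * (- c) ^ (m - 1) / (v ^ m - (- c) ^ m) else 0))"
      proof -
        have "Re (?V (of_real p)) / (v + c) = (if c < 0 then real m * (- c) ^ (m - 1) / (v ^ m - (- c) ^ m) else 0)"
          unfolding Re_root_kernel_axis[OF m p(1,2)] using p m by auto
        then show ?thesis
          unfolding root_kernel_self[OF m v] one_complex.sel
          by (simp only: add_divide_distrib diff_divide_distrib right_diff_distrib mult_1_right
              times_divide_eq_right[symmetric]) argo
      qed
      ultimately show "((\<lambda>t. (H1 t - H2 t) / (v + c)) \<longlongrightarrow> (L1 - L2) / (v + c) + pi * (1 / (v + c) -
       (if c < 0 then real m * (- c) ^ (m - 1) / (v ^ m - (- c) ^ m) else 0))) at_top"
        by simp
    qed
  qed
qed

text \<open>The substitution \<open>y = t\<^bsup>m\<^esup>\<close>, \<open>u = v\<^bsup>m\<^esup>\<close>.\<close>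
lemma stieltjes_root_integral:
  fixes m :: nat and \<beta> u c :: real
  assumes m: "2 \<le> m" and \<beta>: "\<beta> = 1 / real m" and u: "0 < u" and uc: "0 < u powr \<beta> + c"
  defines "k \<equiv> \<lambda>y. y powr \<beta> * sin (pi * \<beta>) /
      ((y + u) * (c\<^sup>2 + 2 * c * y powr \<beta> * cos (pi * \<beta>) + y powr (2 * \<beta>)))"
    and "s \<equiv> (- c) powr (1 / \<beta>)"
  shows "set_integrable lborel {0<..} k"
    and "(LINT y:{0<..}|lborel. k y) =
      pi * (1 / (u powr \<beta> + c) - (if c < 0 then 1 / (\<beta> * s powr (\<beta> - 1) * (u - s)) else 0))"
    and "\<And>y. 0 < y \<Longrightarrow> 0 \<le> k y"
proof -
  have \<beta>0: "0 < \<beta>" using m by (simp add: \<beta>)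
  define v where "v = u powr \<beta>"
  have v: "0 < v" using u by (simp add: v_def)
  have power_m: "(y powr \<beta>) ^ m = y" if "0 < y" for y
    using that m by (simp add: \<beta> powr_powr flip: powr_realpow)
  have vm: "v ^ m = u" using power_m[OF u] by (simp add: v_def)
  obtain H L where H: "\<And>t. 0 < t \<Longrightarrow> (H has_real_derivative
       real m * t ^ (m - 1) / (t ^ m + v ^ m) *
       (t * sin (pi / m) / (c\<^sup>2 + 2 * c * t * cos (pi / m) + t\<^sup>2))) (at t)"
    "(H \<longlongrightarrow> L) (at_right 0)"
    "(H \<longlongrightarrow> L + pi * (1 / (v + c) -
       (if c < 0 then real m * (- c) ^ (m - 1) / (v ^ m - (- c) ^ m) else 0))) at_top"
    using rational_ray_antiderivative[OF m v, of c] uc by (auto simp: v_def)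
  have sin_pos: "0 < sin (pi * \<beta>)" using m \<beta>0 by (intro sin_gt_zero) (auto simp: \<beta> divide_less_eq)
  have denom_pos: "0 < c\<^sup>2 + 2 * c * y powr \<beta> * cos (pi * \<beta>) + y powr (2 * \<beta>)" if y: "0 < y" for y
  proof -
    \<comment> \<open>The expression is the squared modulus of
      \<open>c + y powr \<beta> * cis (pi * \<beta>)\<close>, whose imaginary part is
      positive.\<close>
    have "c\<^sup>2 + 2 * c * y powr \<beta> * cos (pi * \<beta>) + y powr (2 * \<beta>) =
        (c + y powr \<beta> * cos (pi * \<beta>))\<^sup>2 + (y powr \<beta> * sin (pi * \<beta>))\<^sup>2"
    proof -
      have "y powr (2 * \<beta>) = (y powr \<beta>)\<^sup>2" using powr_add[of y \<beta> \<beta>] by (simp add: power2_eq_square)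
      then show ?thesis using sin_cos_squared_add[of "pi * \<beta>"] by algebra
    qed
    also have "\<dots> > 0" using y sin_pos by (intro add_nonneg_pos) auto
    finally show ?thesis .
  qed
  show nonneg: "0 \<le> k y" if "0 < y" for y
    using denom_pos[OF that] sin_pos u that by (simp add: k_def)
  have deriv: "((\<lambda>y. H (y powr \<beta>)) has_real_derivative k y) (at y)" if y: "0 < y" for y
  proof -
    let ?t = "y powr \<beta>"
    have t: "0 < ?t" using y by simp
    have "((\<lambda>y. y powr \<beta>) has_real_derivative \<beta> * y powr (\<beta> - 1)) (at y)"
      using y by (auto intro!: derivative_eq_intros)
    from DERIV_chain2[OF H(1)[OF t] this]
    have "((\<lambda>y. H (y powr \<beta>)) has_real_derivative
       real m * ?t ^ (m - 1) / (?t ^ m + v ^ m) *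
       (?t * sin (pi / m) / (c\<^sup>2 + 2 * c * ?t * cos (pi / m) + ?t\<^sup>2)) * (\<beta> * y powr (\<beta> - 1))) (at y)" .
    moreover have "real m * ?t ^ (m - 1) / (?t ^ m + v ^ m) *
       (?t * sin (pi / m) / (c\<^sup>2 + 2 * c * ?t * cos (pi / m) + ?t\<^sup>2)) * (\<beta> * y powr (\<beta> - 1)) = k y"
    proof -
      \<comment> \<open>The derivative of the substitution cancels the factor
        \<open>m t^(m-1)\<close>.\<close>
      have "?t ^ (m - 1) * ?t = y" using power_m[OF y] power_minus_mult[of m ?t] m by simp
      then have "?t ^ (m - 1) * y powr (\<beta> - 1) = 1" using y by (simp add: powr_diff field_simps)
      then have one: "real m * ?t ^ (m - 1) * (\<beta> * y powr (\<beta> - 1)) = 1" using m by (simp add: \<beta>)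
      have "?t\<^sup>2 = y powr (2 * \<beta>)" using powr_add[of y \<beta> \<beta>] by (simp add: power2_eq_square)
      moreover have "pi / real m = pi * \<beta>" by (simp add: \<beta>)
      moreover have "real m * ?t ^ (m - 1) / A * (B / C) * (\<beta> * y powr (\<beta> - 1)) = B / (A * C)" for A B C :: real
      proof -
        have "real m * ?t ^ (m - 1) / A * (B / C) * (\<beta> * y powr (\<beta> - 1)) =
            (real m * ?t ^ (m - 1) * (\<beta> * y powr (\<beta> - 1))) * B / (A * C)"
          by (simp add: ac_simps)
        then show ?thesis unfolding one by simp
      qed
      ultimately show ?thesis
        unfolding k_def power_m[OF y] vm by simp
    qed
    ultimately show ?thesis by simp
  qed
  have cont: "isCont k y" if "0 < y" for y
    using that denom_pos[OF that] u unfolding k_def by (intro continuous_intros) auto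
  have lim0: "((\<lambda>y. H (y powr \<beta>)) \<longlongrightarrow> L) (at_right 0)"
  proof (rule filterlim_compose[OF H(2)])
    show "filterlim (\<lambda>y. y powr \<beta>) (at_right 0) (at_right 0)"
      using \<beta>0 by real_asymp
  qed
  have lim1: "((\<lambda>y. H (y powr \<beta>)) \<longlongrightarrow> L + pi * (1 / (v + c) -
       (if c < 0 then real m * (- c) ^ (m - 1) / (v ^ m - (- c) ^ m) else 0))) at_top"
  proof (rule filterlim_compose[OF H(3)])
    show "filterlim (\<lambda>y. y powr \<beta>) at_top at_top"
      using \<beta>0 by real_asymp
  qed
  \<comment> \<open>Since the integrand is nonnegative, finite limits of the antiderivative at both
    ends yield integrability along with the value.\<close>
  note FTC = interval_integral_FTC_nonneg[of 0 \<infinity> "\<lambda>y. H (y powr \<beta>)" k, OF _ deriv cont _ _ _,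
      unfolded zero_ereal_def ereal_tendsto_simps ereal_less_eq less_ereal.simps]
  have ein: "einterval (ereal 0) \<infinity> = {0<..}" by (auto simp: einterval_def)
  show "set_integrable lborel {0<..} k"
    using FTC(1)[OF _ _ _ _ lim0 lim1] nonneg unfolding ein by simp
  have "(LINT y:{0<..}|lborel. k y) = pi * (1 / (v + c) -
       (if c < 0 then real m * (- c) ^ (m - 1) / (v ^ m - (- c) ^ m) else 0))"
    using FTC(2)[OF _ _ _ _ lim0 lim1] nonneg
    unfolding interval_lebesgue_integral_def ein by simp
  \<comment> \<open>Back in the variable \<open>u\<close>, the pole \<open>- c\<close> corresponds
    to \<open>s = (- c)^m\<close>, and \<open>s powr (\<beta> - 1)\<close> is the inverse of
    \<open>(- c)^(m-1)\<close>.\<close>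
  moreover have "real m * (- c) ^ (m - 1) / (v ^ m - (- c) ^ m) = 1 / (\<beta> * s powr (\<beta> - 1) * (u - s))"
    if c: "c < 0"
  proof -
    have s: "s = (- c) ^ m" using c m by (simp add: s_def \<beta> powr_realpow)
    have "s powr (\<beta> - 1) = (- c) powr (real m * (\<beta> - 1))"
      using c by (simp add: s powr_powr flip: powr_realpow)
    also have "real m * (\<beta> - 1) = - real (m - 1)" using m by (simp add: \<beta> field_simps of_nat_diff)
    also have "(- c) powr - real (m - 1) = inverse ((- c) ^ (m - 1))"
      using c by (simp only: powr_minus powr_realpow neg_0_less_iff_less)
    finally show ?thesis using m unfolding vm s[symmetric] by (simp add: \<beta> field_simps)
  qed
  ultimately show "(LINT y:{0<..}|lborel. k y) =
      pi * (1 / (u powr \<beta> + c) - (if c < 0 then 1 / (\<beta> * s powr (\<beta> - 1) * (u - s)) else 0))"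
    by (auto simp: v_def)
qed

section \<open>Laplace transforms determine laws\<close>

text \<open>For a variable bounded by 1 the partial sums of the exponential series are dominated by
  \<open>exp \<bar>t\<bar>\<close>, so expectation and series may be interchanged and only moments
  enter.\<close>

lemma (in prob_space) char_distr_bounded_eq_limit_moments:
  assumes [measurable]: "U \<in> borel_measurable M" and U: "AE x in M. \<bar>U x\<bar> \<le> 1"
  shows "(\<lambda>n. \<Sum>k<n. (\<i> * complex_of_real t) ^ k / fact k * complex_of_real (expectation (\<lambda>x. U x ^ k)))
    \<longlonglongrightarrow> char (distr M borel U) t"
proof -
  have itg: "integrable M (\<lambda>x. (\<i> * complex_of_real t) ^ k / fact k * complex_of_real (U x ^ k))" for k
  proof -
    have "AE x in M. norm (U x ^ k) \<le> 1"
      using U by eventually_elim (simp add: power_abs power_le_one)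
    then have "integrable M (\<lambda>x. U x ^ k)"
      by (rule integrable_const_bound) measurable
    then show ?thesis
      by (intro integrable_mult_right integrable_of_real)
  qed
  have bound: "norm (\<Sum>k<n. (\<i> * complex_of_real t) ^ k / fact k * complex_of_real (U x ^ k)) \<le> exp \<bar>t\<bar>"
    if "\<bar>U x\<bar> \<le> 1" for n x
  proof -
    have "norm (\<Sum>k<n. (\<i> * complex_of_real t) ^ k / fact k * complex_of_real (U x ^ k))
        \<le> (\<Sum>k<n. \<bar>t\<bar> ^ k / fact k)"
    proof (rule sum_norm_le)
      fix k
      have "\<bar>U x\<bar> ^ k \<le> 1" using that by (simp add: power_le_one)
      then show "norm ((\<i> * complex_of_real t) ^ k / fact k * complex_of_real (U x ^ k)) \<le> \<bar>t\<bar> ^ k / fact k"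
        using mult_left_mono[of "\<bar>U x\<bar> ^ k" 1 "\<bar>t\<bar> ^ k / fact k"]
        by (simp add: norm_mult norm_power norm_divide power_abs)
    qed
    also have "\<dots> \<le> exp \<bar>t\<bar>"
      using sum_le_suminf[OF summable_exp[of "\<bar>t\<bar>"], of "{..<n}"]
      by (simp add: exp_def divide_inverse mult.commute)
    finally show ?thesis .
  qed
  have "(\<lambda>n. \<integral>x. (\<Sum>k<n. (\<i> * complex_of_real t) ^ k / fact k * complex_of_real (U x ^ k)) \<partial>M)
      \<longlonglongrightarrow> (\<integral>x. iexp (t * U x) \<partial>M)"
  proof (rule integral_dominated_convergence[where w = "\<lambda>_. exp \<bar>t\<bar>"])
    show "AE x in M. (\<lambda>n. \<Sum>k<n. (\<i> * complex_of_real t) ^ k / fact k * complex_of_real (U x ^ k))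
        \<longlonglongrightarrow> iexp (t * U x)"
    proof (rule AE_I2)
      fix x
      have "(\<lambda>k. (\<i> * complex_of_real (t * U x)) ^ k /\<^sub>R fact k) sums iexp (t * U x)"
        by (rule exp_converges)
      then show "(\<lambda>n. \<Sum>k<n. (\<i> * complex_of_real t) ^ k / fact k * complex_of_real (U x ^ k))
        \<longlonglongrightarrow> iexp (t * U x)"
        by (simp add: sums_def power_mult_distrib scaleR_conv_of_real field_simps)
    qed
    show "AE x in M. norm (\<Sum>k<n. (\<i> * complex_of_real t) ^ k / fact k * complex_of_real (U x ^ k)) \<le> exp \<bar>t\<bar>" for n
      using U by eventually_elim (rule bound)
  qed measurable
  moreover have "char (distr M borel U) t = (\<integral>x. iexp (t * U x) \<partial>M)"
    unfolding char_def by (subst integral_distr) auto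
  moreover have "(\<integral>x. (\<Sum>k<n. (\<i> * complex_of_real t) ^ k / fact k * complex_of_real (U x ^ k)) \<partial>M) =
      (\<Sum>k<n. (\<i> * complex_of_real t) ^ k / fact k * complex_of_real (expectation (\<lambda>x. U x ^ k)))" for n
    by (subst Bochner_Integration.integral_sum[OF itg]) (simp only: integral_mult_right_zero integral_complex_of_real)
  ultimately show ?thesis by simp
qed

text \<open>The transform at the positive integers gives the moments of the bounded variable
  \<open>exp (- x)\<close>, and these determine its characteristic function.\<close>
lemma laplace_transform_unique:
  assumes N1: "prob_space N1" "sets N1 = sets borel" "AE x in N1. 0 \<le> x"
    and N2: "prob_space N2" "sets N2 = sets borel" "AE x in N2. 0 \<le> x"
    and eq: "\<And>k::nat. 1 \<le> k \<Longrightarrow>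
      laplace_transform N1 (\<lambda>x. x) (real k) = laplace_transform N2 (\<lambda>x. x) (real k)"
  shows "N1 = N2"
proof -
  let ?U = "\<lambda>x::real. exp (- x)"
  \<comment> \<open>Nothing is lost by passing to \<open>exp (- x)\<close>: the map
    \<open>- ln\<close> recovers the law.\<close>
  have N: "real_distribution (distr N borel ?U)" "distr (distr N borel ?U) borel (\<lambda>x. - ln x) = N"
    "(\<lambda>n. \<Sum>k<n. (\<i> * complex_of_real t) ^ k / fact k * complex_of_real (\<integral>x. ?U x ^ k \<partial>N))
    \<longlonglongrightarrow> char (distr N borel ?U) t"
    if N: "prob_space N" "sets N = sets borel" "AE x in N. 0 \<le> x" for N t
  proof -
    interpret prob_space N by fact
    have [measurable_cong]: "sets N = sets borel" by fact
    interpret D: prob_space "distr N borel ?U" by (rule prob_space_distr) simp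
    show "real_distribution (distr N borel ?U)" by unfold_locales auto
    show "distr (distr N borel ?U) borel (\<lambda>x. - ln x) = N"
      by (subst distr_distr) (auto simp: comp_def intro!: distr_id2[OF N(2)[symmetric], simplified])
    show "(\<lambda>n. \<Sum>k<n. (\<i> * complex_of_real t) ^ k / fact k * complex_of_real (\<integral>x. ?U x ^ k \<partial>N))
      \<longlonglongrightarrow> char (distr N borel ?U) t"
      by (rule char_distr_bounded_eq_limit_moments) (use N(3) in \<open>auto elim!: eventually_mono\<close>)
  qed
  \<comment> \<open>The zeroth moment is the total mass; the others are values of the transform at
    positive integers.\<close>
  have moments: "(\<integral>x. ?U x ^ k \<partial>N1) = (\<integral>x. ?U x ^ k \<partial>N2)" for k
  proof (cases "k = 0")
    case True
    then show ?thesis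
      using prob_space.prob_space[OF N1(1)] prob_space.prob_space[OF N2(1)] by simp
  next
    case False
    then show ?thesis
      using eq[of k] by (simp add: laplace_transform_def flip: exp_of_nat_mult)
  qed
  have "char (distr N1 borel ?U) = char (distr N2 borel ?U)"
  proof
    fix t
    show "char (distr N1 borel ?U) t = char (distr N2 borel ?U) t"
      using N(3)[OF N1, of t] N(3)[OF N2, of t] by (simp only: moments) (rule LIMSEQ_unique)
  qed
  then have "distr N1 borel ?U = distr N2 borel ?U"
    by (intro Levy_uniqueness N(1) N1 N2)
  then show ?thesis using N(2)[OF N1] N(2)[OF N2] by metis
qed

section \<open>The autoregressive recursion\<close>

text \<open>The right-hand family is itself a sigma-algebra, pulled back along \<open>V\<close>, for
  which the composite is measurable. This links the preimage families of
  \<open>indep_elements\<close> with the generated sigma-algebras of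
  \<open>indep_var\<close>.\<close>

lemma sigma_sets_vimage_compose_subset:
  fixes h :: "'b \<Rightarrow> real"
  assumes V: "V \<in> measurable M N" and h: "h \<in> borel_measurable N"
  shows "sigma_sets (space M) {(\<lambda>\<omega>. h (V \<omega>)) -` A \<inter> space M | A. A \<in> sets borel}
      \<subseteq> {V -` A \<inter> space M | A. A \<in> sets N}"
proof -
  have V': "V \<in> space M \<rightarrow> space N"
    using measurable_space[OF V] by auto
  have "(\<lambda>\<omega>. h (V \<omega>)) \<in> borel_measurable (vimage_algebra (space M) V N)"
    by (rule measurable_compose[OF measurable_vimage_algebra1[OF V'] h])
  then have "{(\<lambda>\<omega>. h (V \<omega>)) -` A \<inter> space M | A. A \<in> sets borel} \<subseteq> sets (vimage_algebra (space M) V N)"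
    by (auto simp: measurable_def)
  from sets.sigma_sets_subset[OF this] show ?thesis
    by (simp add: sets_vimage_algebra2[OF V'])
qed

text \<open>Independence passes to smaller sigma-algebras. Composing with real functions brings both
  elements to one type, where the product formula for expectations is available.\<close>

lemma (in prob_space) indep_elements_imp_indep_var:
  assumes "indep_elements N1 X N2 Z"
    and f: "f \<in> borel_measurable N1" and g: "g \<in> borel_measurable N2"
  shows "indep_var borel (\<lambda>\<omega>. f (X \<omega>) :: real) borel (\<lambda>\<omega>. g (Z \<omega>) :: real)"
proof -
  have X: "X \<in> measurable M N1" and Z: "Z \<in> measurable M N2"
    and ind: "indep_set {X -` A \<inter> space M | A. A \<in> sets N1} {Z -` A \<inter> space M | A. A \<in> sets N2}"
    using assms(1) by (auto simp: indep_elements_def)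
  have "indep_set (sigma_sets (space M) {(\<lambda>\<omega>. f (X \<omega>)) -` A \<inter> space M | A. A \<in> sets borel})
      (sigma_sets (space M) {(\<lambda>\<omega>. g (Z \<omega>)) -` A \<inter> space M | A. A \<in> sets borel})"
    using ind subsetD[OF sigma_sets_vimage_compose_subset[OF X f]]
      subsetD[OF sigma_sets_vimage_compose_subset[OF Z g]]
    unfolding indep_sets2_eq by (meson subset_iff)
  then show ?thesis
    using measurable_compose[OF X f] measurable_compose[OF Z g] by (simp add: indep_var_eq)
qed

text \<open>The indicator of the choice is independent of every function of the innovation and the
  past, so its expectation \<open>\<theta>\<close> factors out; the complementary event follows by
  subtraction.\<close>

lemma (in ar1_process) choice_independent_mult:
  assumes n: "1 \<le> n" and g: "g \<in> borel_measurable (borel \<Otimes>\<^sub>M Pi\<^sub>M {..<n} (\<lambda>_. borel))"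
    and int: "integrable M (\<lambda>\<omega>. g (\<epsilon> n \<omega>, \<lambda>k\<in>{..<n}. Y k \<omega>))"
  shows "expectation (\<lambda>\<omega>. of_bool (B n \<omega>) * g (\<epsilon> n \<omega>, \<lambda>k\<in>{..<n}. Y k \<omega>)) =
      \<theta> * expectation (\<lambda>\<omega>. g (\<epsilon> n \<omega>, \<lambda>k\<in>{..<n}. Y k \<omega>))"
    and "expectation (\<lambda>\<omega>. of_bool (\<not> B n \<omega>) * g (\<epsilon> n \<omega>, \<lambda>k\<in>{..<n}. Y k \<omega>)) =
      (1 - \<theta>) * expectation (\<lambda>\<omega>. g (\<epsilon> n \<omega>, \<lambda>k\<in>{..<n}. Y k \<omega>))"
    and "integrable M (\<lambda>\<omega>. of_bool (B n \<omega>) * g (\<epsilon> n \<omega>, \<lambda>k\<in>{..<n}. Y k \<omega>))"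
    and "integrable M (\<lambda>\<omega>. of_bool (\<not> B n \<omega>) * g (\<epsilon> n \<omega>, \<lambda>k\<in>{..<n}. Y k \<omega>))"
proof -
  have iv: "indep_var borel (\<lambda>\<omega>. of_bool (B n \<omega>)) borel (\<lambda>\<omega>. g (\<epsilon> n \<omega>, \<lambda>k\<in>{..<n}. Y k \<omega>))"
    by (rule indep_elements_imp_indep_var[OF choice_indep[OF n] _ g]) simp
  have B [measurable]: "B n \<in> measurable M (count_space UNIV)"
    using choice_indep[OF n] by (simp add: indep_elements_def)
  have iB: "integrable M (\<lambda>\<omega>. of_bool (B n \<omega>) :: real)"
    by (rule integrable_const_bound[of _ 1]) simp_all
  have "(\<lambda>\<omega>. of_bool (B n \<omega>)) = (indicator {\<omega>. B n \<omega>} :: 'a \<Rightarrow> real)"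
    by (auto simp: fun_eq_iff indicator_def)
  then have eB: "expectation (\<lambda>\<omega>. of_bool (B n \<omega>)) = \<theta>"
    using choice_prob[OF n] by (simp add: Int_def conj_commute)
  show 1: "expectation (\<lambda>\<omega>. of_bool (B n \<omega>) * g (\<epsilon> n \<omega>, \<lambda>k\<in>{..<n}. Y k \<omega>)) =
      \<theta> * expectation (\<lambda>\<omega>. g (\<epsilon> n \<omega>, \<lambda>k\<in>{..<n}. Y k \<omega>))"
    using indep_var_lebesgue_integral[OF iv iB int] eB by simp
  show 3: "integrable M (\<lambda>\<omega>. of_bool (B n \<omega>) * g (\<epsilon> n \<omega>, \<lambda>k\<in>{..<n}. Y k \<omega>))"
    by (rule indep_var_integrable[OF iv iB int])
  have neg: "of_bool (\<not> B n \<omega>) * g (\<epsilon> n \<omega>, \<lambda>k\<in>{..<n}. Y k \<omega>) =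
      g (\<epsilon> n \<omega>, \<lambda>k\<in>{..<n}. Y k \<omega>) - of_bool (B n \<omega>) * g (\<epsilon> n \<omega>, \<lambda>k\<in>{..<n}. Y k \<omega>)" for \<omega>
    by simp
  show "integrable M (\<lambda>\<omega>. of_bool (\<not> B n \<omega>) * g (\<epsilon> n \<omega>, \<lambda>k\<in>{..<n}. Y k \<omega>))"
    unfolding neg by (rule Bochner_Integration.integrable_diff[OF int 3])
  show "expectation (\<lambda>\<omega>. of_bool (\<not> B n \<omega>) * g (\<epsilon> n \<omega>, \<lambda>k\<in>{..<n}. Y k \<omega>)) =
      (1 - \<theta>) * expectation (\<lambda>\<omega>. g (\<epsilon> n \<omega>, \<lambda>k\<in>{..<n}. Y k \<omega>))"
    unfolding neg Bochner_Integration.integral_diff[OF int 3] 1 by (simp only: left_diff_distrib mult_1)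
qed

lemma (in ar1_process) innovation_measurable:
  assumes "1 \<le> n"
  shows "\<epsilon> n \<in> borel_measurable M"
  using innovation_indep_past[OF assms] by (simp add: indep_elements_def)

text \<open>On the event \<open>B n\<close>, which has positive probability and is independent of
  \<open>\<epsilon> n\<close>, the innovation coincides with the nonnegative variable \<open>Y n\<close>.\<close>
lemma (in ar1_process) innovation_nonneg:
  assumes n: "1 \<le> n" and "0 < \<theta>" and Y: "AE \<omega> in M. 0 \<le> Y n \<omega>"
  shows "AE \<omega> in M. 0 \<le> \<epsilon> n \<omega>"
proof -
  note [measurable] = innovation_measurable[OF n]
  let ?g = "\<lambda>(e, p). indicator {..<0::real} e :: real"
  have ind: "integrable M (\<lambda>\<omega>. indicator {..<0} (\<epsilon> n \<omega>) :: real)"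
    by (rule integrable_const_bound[of _ 1]) (simp_all add: indicator_def)
  have "expectation (\<lambda>\<omega>. of_bool (B n \<omega>) * ?g (\<epsilon> n \<omega>, \<lambda>k\<in>{..<n}. Y k \<omega>)) = 0"
  proof (rule integral_eq_zero_AE)
    show "AE \<omega> in M. of_bool (B n \<omega>) * ?g (\<epsilon> n \<omega>, \<lambda>k\<in>{..<n}. Y k \<omega>) = 0"
      using recursion[OF n] Y by eventually_elim auto
  qed
  moreover have "expectation (\<lambda>\<omega>. of_bool (B n \<omega>) * ?g (\<epsilon> n \<omega>, \<lambda>k\<in>{..<n}. Y k \<omega>)) =
      \<theta> * expectation (\<lambda>\<omega>. ?g (\<epsilon> n \<omega>, \<lambda>k\<in>{..<n}. Y k \<omega>))"
    by (rule choice_independent_mult(1)[OF n]) (measurable, simp add: ind)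
  ultimately have "expectation (\<lambda>\<omega>. indicator {..<0} (\<epsilon> n \<omega>) :: real) = 0"
    using \<open>0 < \<theta>\<close> by simp
  then have "AE \<omega> in M. (indicator {..<0} (\<epsilon> n \<omega>) :: real) = 0"
    using integral_nonneg_eq_0_iff_AE[OF ind] by simp
  then show ?thesis
    by eventually_elim (auto simp: indicator_def split: if_splits)
qed

text \<open>Split according to \<open>B n\<close>. The choice factors out of each alternative, and
  in the second one the exponential of the sum factors again, since the innovation is independent of
  \<open>Y (n - 1)\<close>. Nonnegativity bounds the exponentials by 1 and so gives
  integrability.\<close>

lemma (in ar1_process) laplace_transform_recursion:
  assumes n: "1 \<le> n" and \<theta>: "0 < \<theta>" and Y: "\<And>k. AE \<omega> in M. 0 \<le> Y k \<omega>" and s: "0 \<le> s"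
  shows "laplace_transform M (Y n) s =
    laplace_transform M (\<epsilon> n) s * (\<theta> + (1 - \<theta>) * laplace_transform M (Y (n - 1)) s)"
proof -
  note [measurable] = innovation_measurable[OF n] Y_measurable
  note eps = innovation_nonneg[OF n \<theta> Y]
  \<comment> \<open>The past vector is \<open>undefined\<close> off \<open>{..<n}\<close>, so
    reading \<open>Y (n - 1)\<close> from it requires this membership.\<close>
  have n': "n - 1 \<in> {..<n}" using n by simp
  let ?g1 = "\<lambda>(e, p). exp (- s * e) :: real"
  let ?g2 = "\<lambda>(e, p). exp (- s * e) * exp (- s * p (n - 1)) :: real"
  let ?v = "\<lambda>\<omega>. (\<epsilon> n \<omega>, \<lambda>k\<in>{..<n}. Y k \<omega>)"
  have m1: "?g1 \<in> borel_measurable (borel \<Otimes>\<^sub>M Pi\<^sub>M {..<n} (\<lambda>_. borel))" by measurable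
  have [measurable]: "(\<lambda>p. p (n - 1)) \<in> borel_measurable (Pi\<^sub>M {..<n} (\<lambda>_. borel :: real measure))"
    by (rule measurable_component_singleton[OF n'])
  have m2: "?g2 \<in> borel_measurable (borel \<Otimes>\<^sub>M Pi\<^sub>M {..<n} (\<lambda>_. borel))" by measurable
  have i1: "integrable M (\<lambda>\<omega>. ?g1 (?v \<omega>))"
  proof (rule integrable_const_bound[of _ 1])
    show "AE \<omega> in M. norm (?g1 (?v \<omega>)) \<le> 1"
      using eps by eventually_elim (use s in simp)
  qed simp
  have i3: "integrable M (\<lambda>\<omega>. exp (- s * Y (n - 1) \<omega>))"
  proof (rule integrable_const_bound[of _ 1])
    show "AE \<omega> in M. norm (exp (- s * Y (n - 1) \<omega>)) \<le> 1"
      using Y[of "n - 1"] by eventually_elim (use s in simp)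
  qed simp
  have iv: "indep_var borel (\<lambda>\<omega>. exp (- s * \<epsilon> n \<omega>)) borel
      (\<lambda>\<omega>. (\<lambda>p. exp (- s * p (n - 1))) (\<lambda>k\<in>{..<n}. Y k \<omega>))"
    by (rule indep_elements_imp_indep_var[OF innovation_indep_past[OF n]]) measurable
  then have iv: "indep_var borel (\<lambda>\<omega>. exp (- s * \<epsilon> n \<omega>)) borel (\<lambda>\<omega>. exp (- s * Y (n - 1) \<omega>))"
    using n' by simp
  have i2: "integrable M (\<lambda>\<omega>. ?g2 (?v \<omega>))"
    using indep_var_integrable[OF iv _ i3] i1 n' by simp
  have e2: "expectation (\<lambda>\<omega>. ?g2 (?v \<omega>)) =
      laplace_transform M (\<epsilon> n) s * laplace_transform M (Y (n - 1)) s"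
    using indep_var_lebesgue_integral[OF iv _ i3] i1 n' by (simp add: laplace_transform_def)
  have "laplace_transform M (Y n) s =
      expectation (\<lambda>\<omega>. of_bool (B n \<omega>) * ?g1 (?v \<omega>) + of_bool (\<not> B n \<omega>) * ?g2 (?v \<omega>))"
    unfolding laplace_transform_def
  proof (rule integral_cong_AE)
    have [measurable]: "B n \<in> measurable M (count_space UNIV)"
      using choice_indep[OF n] by (simp add: indep_elements_def)
    show "(\<lambda>\<omega>. of_bool (B n \<omega>) * ?g1 (?v \<omega>) + of_bool (\<not> B n \<omega>) * ?g2 (?v \<omega>)) \<in> borel_measurable M"
      using n' by simp
    have exp_split: "exp (- (s * (y + e))) = exp (- (s * e)) * exp (- (s * y))" for y e :: real
      unfolding exp_add[symmetric] by (simp add: distrib_left)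
    show "AE \<omega> in M. exp (- s * Y n \<omega>) =
        of_bool (B n \<omega>) * ?g1 (?v \<omega>) + of_bool (\<not> B n \<omega>) * ?g2 (?v \<omega>)"
      using recursion[OF n] by eventually_elim (use n' in \<open>simp add: exp_split\<close>)
  qed simp
  also have "\<dots> = expectation (\<lambda>\<omega>. of_bool (B n \<omega>) * ?g1 (?v \<omega>)) +
      expectation (\<lambda>\<omega>. of_bool (\<not> B n \<omega>) * ?g2 (?v \<omega>))"
    by (rule Bochner_Integration.integral_add[OF choice_independent_mult(3)[OF n m1 i1]
        choice_independent_mult(4)[OF n m2 i2]])
  also have "\<dots> = \<theta> * laplace_transform M (\<epsilon> n) s +
      (1 - \<theta>) * (laplace_transform M (\<epsilon> n) s * laplace_transform M (Y (n - 1)) s)"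
    unfolding choice_independent_mult(1)[OF n m1 i1] choice_independent_mult(2)[OF n m2 i2] e2
    by (simp add: laplace_transform_def)
  finally show ?thesis by (simp add: algebra_simps)
qed

section \<open>The density of the innovations\<close>

lemma nn_integral_exp_half_line:
  assumes a: "0 < a"
  shows "(\<integral>\<^sup>+x. ennreal (exp (- a * x)) * indicator {0<..} x \<partial>lborel) = ennreal (1 / a)"
proof -
  have "(\<integral>\<^sup>+x. ennreal (exp (- a * x)) * indicator {0<..} x \<partial>lborel) =
      (\<integral>\<^sup>+x. ennreal (exp (- a * x)) * indicator {0..} x \<partial>lborel)"
  proof (rule nn_integral_cong_AE)
    show "AE x in lborel. ennreal (exp (- a * x)) * indicator {0<..} x =
        ennreal (exp (- a * x)) * indicator {0..} x"
      using AE_lborel_singleton[of 0] by eventually_elim (auto simp: indicator_def)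
  qed
  also have "\<dots> = ennreal (0 - - exp (- a * 0) / a)"
  proof (rule nn_integral_FTC_atLeast)
    show "((\<lambda>x. - exp (- a * x) / a) has_real_derivative exp (- a * x)) (at x)" for x
      using a by (auto intro!: derivative_eq_intros)
    show "((\<lambda>x. - exp (- a * x) / a) \<longlongrightarrow> 0) at_top"
      using a by real_asymp
  qed auto
  finally show ?thesis by simp
qed

section \<open>The candidate law, built from the parameters alone\<close>

locale innovation_law =
  fixes \<theta> lam \<beta> :: real and m :: nat
  assumes \<theta>: "0 < \<theta>" and lam: "0 < lam" and m: "2 \<le> m" and \<beta>: "\<beta> = 1 / real m"
begin

text \<open>With this constant \<open>1 + \<theta> * (u powr \<beta> - lam powr \<beta>)\<close>
  equals \<open>\<theta> * (u powr \<beta> + c)\<close>, so a pole requires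
  \<open>u powr \<beta> = - c\<close>.\<close>

definition c :: real where "c = 1 / \<theta> - lam powr \<beta>"

text \<open>Up to a constant, the jump of \<open>1 / (z powr \<beta> + c)\<close> across the cut at
  \<open>z = - y\<close>, divided by \<open>y + u\<close>.\<close>

definition stieltjes_integrand :: "real \<Rightarrow> real \<Rightarrow> real" where
  "stieltjes_integrand u y = y powr \<beta> * sin (pi * \<beta>) /
      ((y + u) * (c\<^sup>2 + 2 * c * y powr \<beta> * cos (pi * \<beta>) + y powr (2 * \<beta>)))"

lemma \<beta>_pos: "0 < \<beta>"
  using m by (simp add: \<beta>)

lemma powr_add_c_pos:
  assumes "lam \<le> u"
  shows "0 < u powr \<beta> + c"
proof -
  have "lam powr \<beta> \<le> u powr \<beta>" using assms lam \<beta>_pos by (intro powr_mono2) auto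
  moreover have "0 < 1 / \<theta>" using \<theta> by simp
  ultimately show ?thesis unfolding c_def by linarith
qed

lemmas stieltjes = stieltjes_root_integral[OF m \<beta> _ powr_add_c_pos, folded stieltjes_integrand_def]

lemma s0_eq: "s0 \<theta> lam \<beta> = (- c) powr (1 / \<beta>)"
  by (simp add: s0_def c_def)

lemma c_neg_iff: "1 / \<theta> < lam powr \<beta> \<longleftrightarrow> c < 0"
  by (simp add: c_def)

text \<open>The pole lies to the left of \<open>lam\<close>, so the residue exponential decays and
  its transform converges for every \<open>s \<ge> 0\<close>.\<close>

lemma s0_less:
  assumes "c < 0"
  shows "s0 \<theta> lam \<beta> < lam"
proof -
  have "- c < lam powr \<beta>" using \<theta> by (simp add: c_def)
  then have "(- c) powr (1 / \<beta>) < (lam powr \<beta>) powr (1 / \<beta>)"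
    using assms \<beta>_pos by (intro powr_less_mono2) auto
  then show ?thesis using lam \<beta>_pos by (simp add: s0_eq powr_powr)
qed

text \<open>The denominator of the cut integrand is \<open>\<theta>^2\<close> times the squared
  modulus. The factor \<open>y + u\<close> is inserted and cancels, which leaves \<open>u\<close>
  free: \<open>lam\<close> serves for bounds, \<open>s + lam\<close> for the transform.\<close>

lemma cut_integrand_eq:
  assumes y: "0 < y" and u: "0 < u"
  shows "cut_integrand \<theta> lam \<beta> x y = exp (- (y + lam) * x) * (y + u) / \<theta> * stieltjes_integrand u y"
proof -
  let ?E = "c\<^sup>2 + 2 * c * y powr \<beta> * cos (pi * \<beta>) + y powr (2 * \<beta>)"
  have "\<theta> * c = 1 - \<theta> * lam powr \<beta>" using \<theta> by (simp add: c_def right_diff_distrib)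
  moreover have "lam powr (2 * \<beta>) = (lam powr \<beta>)\<^sup>2"
    using powr_add[of lam \<beta> \<beta>] by (simp add: power2_eq_square)
  ultimately have "1 + 2 * \<theta> * (y powr \<beta> * cos (pi * \<beta>) - lam powr \<beta>)
        + \<theta>\<^sup>2 * (y powr (2 * \<beta>) - 2 * lam powr \<beta> * y powr \<beta> * cos (pi * \<beta>) + lam powr (2 * \<beta>))
      = \<theta>\<^sup>2 * ?E"
    by algebra
  then have "cut_integrand \<theta> lam \<beta> x y = \<theta> * exp (- x * (y + lam)) * y powr \<beta> * sin (pi * \<beta>) / (\<theta>\<^sup>2 * ?E)"
    by (simp add: cut_integrand_def)
  also have "\<dots> = exp (- x * (y + lam)) * (y + u) / \<theta> * (y powr \<beta> * sin (pi * \<beta>) / ((y + u) * ?E))"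
    using \<theta> y u by (simp add: power2_eq_square)
  also have "- x * (y + lam) = - (y + lam) * x" by (simp add: algebra_simps)
  finally show ?thesis by (simp only: stieltjes_integrand_def)
qed

lemma cut_integrand_nonneg:
  assumes "0 < y"
  shows "0 \<le> cut_integrand \<theta> lam \<beta> x y"
  unfolding cut_integrand_eq[OF assms lam] using stieltjes(3)[OF lam order_refl assms] \<theta> lam assms
  by (intro mult_nonneg_nonneg divide_nonneg_nonneg) auto

lemma cut_integrand_measurable [measurable]:
  "(\<lambda>(x, y). cut_integrand \<theta> lam \<beta> x y) \<in> borel_measurable (borel \<Otimes>\<^sub>M borel)"
  unfolding cut_integrand_def by measurable

text \<open>The exponential absorbs the inserted factor, since
  \<open>z * exp (- z * x) \<le> 1 / x\<close>; a multiple of the Stieltjes integrand at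
  \<open>lam\<close> is thus an integrable majorant.\<close>

lemma set_integrable_cut_integrand:
  assumes x: "0 < x"
  shows "set_integrable lborel {0<..} (cut_integrand \<theta> lam \<beta> x)"
proof (rule set_integrable_bound)
  show "set_integrable lborel {0<..} (\<lambda>y. 1 / (x * \<theta>) * stieltjes_integrand lam y)"
    by (intro set_integrable_mult_right stieltjes(1) lam order_refl)
  show "set_borel_measurable lborel {0<..} (cut_integrand \<theta> lam \<beta> x)"
    unfolding set_borel_measurable_def cut_integrand_def by measurable
  show "AE y in lborel. y \<in> {0<..} \<longrightarrow>
      norm (cut_integrand \<theta> lam \<beta> x y) \<le> norm (1 / (x * \<theta>) * stieltjes_integrand lam y)"
  proof (intro AE_I2 impI)
    fix y :: real assume "y \<in> {0<..}"
    then have y: "0 < y" by simp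
    let ?z = "y + lam"
    have "exp (- z * x) * z \<le> 1 / x" for z
    proof -
      have "z * x \<le> exp (z * x)" using exp_ge_add_one_self[of "z * x"] by linarith
      then show ?thesis using x by (simp add: exp_minus divide_simps)
    qed
    from this[of ?z] have "exp (- ?z * x) * ?z / \<theta> * stieltjes_integrand lam y \<le> 1 / x / \<theta> * stieltjes_integrand lam y"
      using \<theta> stieltjes(3)[OF lam order_refl y] by (intro mult_right_mono divide_right_mono) auto
    then have "cut_integrand \<theta> lam \<beta> x y \<le> 1 / (x * \<theta>) * stieltjes_integrand lam y"
      using cut_integrand_eq[OF y lam] by simp
    also have "\<dots> \<le> norm (1 / (x * \<theta>) * stieltjes_integrand lam y)"
      unfolding real_norm_def by (rule abs_ge_self)
    finally show "norm (cut_integrand \<theta> lam \<beta> x y) \<le> norm (1 / (x * \<theta>) * stieltjes_integrand lam y)"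
      using cut_integrand_nonneg[OF y] by simp
  qed
qed

definition pdf :: "real \<Rightarrow> real" where
  "pdf x = (if 0 < x then innovation_density \<theta> lam \<beta> x else 0)"

lemma pdf_measurable [measurable]: "pdf \<in> borel_measurable borel"
  unfolding pdf_def innovation_density_def residue_term_def set_lebesgue_integral_def by measurable

lemma residue_term_nonneg: "0 \<le> residue_term \<theta> lam \<beta> x"
  using \<theta> \<beta>_pos by (auto simp: residue_term_def)

text \<open>Both summands are nonnegative, so the density can be treated with extended nonnegative
  integrals, where Tonelli asks only for measurability.\<close>

lemma ennreal_innovation_density:
  assumes x: "0 < x"
  shows "ennreal (innovation_density \<theta> lam \<beta> x) = ennreal (residue_term \<theta> lam \<beta> x) +
    (\<integral>\<^sup>+y. ennreal (1 / pi * cut_integrand \<theta> lam \<beta> x y) * indicator {0<..} y \<partial>lborel)"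
proof -
  let ?g = "\<lambda>y. indicator {0<..} y * (1 / pi * cut_integrand \<theta> lam \<beta> x y)"
  have "integrable lborel ?g"
    using set_integrable_mult_right[OF set_integrable_cut_integrand[OF x], of "1 / pi"]
    by (simp add: set_integrable_def mult.commute)
  moreover have nonneg: "AE y in lborel. 0 \<le> ?g y"
    using cut_integrand_nonneg by (auto simp: indicator_def)
  ultimately have "(\<integral>\<^sup>+y. ennreal (?g y) \<partial>lborel) = ennreal (LINT y|lborel. ?g y)"
    by (rule nn_integral_eq_integral)
  moreover have "(LINT y|lborel. ?g y) = 1 / pi * (LINT y:{0<..}|lborel. cut_integrand \<theta> lam \<beta> x y)"
    unfolding set_integral_mult_right[symmetric] by (simp add: set_lebesgue_integral_def)
  moreover have "(\<integral>\<^sup>+y. ennreal (?g y) \<partial>lborel) =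
      (\<integral>\<^sup>+y. ennreal (1 / pi * cut_integrand \<theta> lam \<beta> x y) * indicator {0<..} y \<partial>lborel)"
    by (intro nn_integral_cong) (auto simp: indicator_def)
  moreover have "0 \<le> (LINT y|lborel. ?g y)"
    by (rule integral_nonneg_AE[OF nonneg])
  ultimately show ?thesis
    unfolding innovation_density_def by (subst ennreal_plus) (auto simp: residue_term_nonneg)
qed

text \<open>A pure exponential in \<open>x\<close>, whose transform is, up to a constant, the term
  that \<open>stieltjes_root_integral\<close> subtracts for \<open>c < 0\<close>.\<close>

lemma nn_laplace_residue_term:
  assumes s: "0 \<le> s"
  shows "(\<integral>\<^sup>+x. ennreal (residue_term \<theta> lam \<beta> x * exp (- s * x)) * indicator {0<..} x \<partial>lborel) =
    ennreal (1 / \<theta> * (if c < 0 then 1 / (\<beta> * s0 \<theta> lam \<beta> powr (\<beta> - 1) * (s + lam - s0 \<theta> lam \<beta>)) else 0))"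
proof (cases "c < 0")
  case True
  let ?s0 = "s0 \<theta> lam \<beta>"
  let ?r = "1 / (\<theta> * \<beta> * ?s0 powr (\<beta> - 1))"
  have a: "0 < s + lam - ?s0" using s0_less[OF True] s by simp
  have r: "0 \<le> ?r" using \<theta> \<beta>_pos by simp
  have "(\<integral>\<^sup>+x. ennreal (residue_term \<theta> lam \<beta> x * exp (- s * x)) * indicator {0<..} x \<partial>lborel) =
      (\<integral>\<^sup>+x. ennreal ?r * (ennreal (exp (- (s + lam - ?s0) * x)) * indicator {0<..} x) \<partial>lborel)"
  proof (intro nn_integral_cong)
    fix x :: real
    have "residue_term \<theta> lam \<beta> x * exp (- s * x) = ?r * (exp ((?s0 - lam) * x) * exp (- s * x))"
      using True by (simp add: residue_term_def c_neg_iff)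
    also have "exp ((?s0 - lam) * x) * exp (- s * x) = exp (- (s + lam - ?s0) * x)"
      unfolding exp_add[symmetric] by (simp add: algebra_simps)
    finally show "ennreal (residue_term \<theta> lam \<beta> x * exp (- s * x)) * indicator {0<..} x =
        ennreal ?r * (ennreal (exp (- (s + lam - ?s0) * x)) * indicator {0<..} x)"
      using r by (simp only: ennreal_mult' exp_ge_zero mult.assoc)
  qed
  also have "\<dots> = ennreal ?r * ennreal (1 / (s + lam - ?s0))"
    by (subst nn_integral_cmult) (simp, simp only: nn_integral_exp_half_line[OF a])
  also have "\<dots> = ennreal (?r * (1 / (s + lam - ?s0)))"
    using r a by (simp only: ennreal_mult')
  finally show ?thesis using True by (simp add: mult.assoc)
next
  case False
  then show ?thesis by (simp add: residue_term_def c_neg_iff)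
qed

text \<open>After Tonelli the integral in \<open>x\<close> of \<open>exp (- (y + u) * x)\<close> is
  \<open>1 / (y + u)\<close>, which cancels the factor inserted by \<open>cut_integrand_eq\<close>
  at \<open>u = s + lam\<close> and leaves the Stieltjes integral.\<close>

lemma nn_laplace_cut_integral:
  assumes s: "0 \<le> s"
  shows "(\<integral>\<^sup>+x. (\<integral>\<^sup>+y. ennreal (1 / pi * cut_integrand \<theta> lam \<beta> x y) * indicator {0<..} y \<partial>lborel)
      * (ennreal (exp (- s * x)) * indicator {0<..} x) \<partial>lborel) =
    ennreal (1 / \<theta> * (1 / ((s + lam) powr \<beta> + c) -
      (if c < 0 then 1 / (\<beta> * s0 \<theta> lam \<beta> powr (\<beta> - 1) * (s + lam - s0 \<theta> lam \<beta>)) else 0)))"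
proof -
  define u where "u = s + lam"
  have u: "0 < u" "lam \<le> u" using s lam by (auto simp: u_def)
  have "(\<integral>\<^sup>+x. (\<integral>\<^sup>+y. ennreal (1 / pi * cut_integrand \<theta> lam \<beta> x y) * indicator {0<..} y \<partial>lborel)
      * (ennreal (exp (- s * x)) * indicator {0<..} x) \<partial>lborel) =
    (\<integral>\<^sup>+x. (\<integral>\<^sup>+y. ennreal (1 / pi * cut_integrand \<theta> lam \<beta> x y) * indicator {0<..} y
      * (ennreal (exp (- s * x)) * indicator {0<..} x) \<partial>lborel) \<partial>lborel)"
    by (intro nn_integral_cong nn_integral_multc[symmetric]) measurable
  also have "\<dots> = (\<integral>\<^sup>+y. (\<integral>\<^sup>+x. ennreal (1 / pi * cut_integrand \<theta> lam \<beta> x y) * indicator {0<..} y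
      * (ennreal (exp (- s * x)) * indicator {0<..} x) \<partial>lborel) \<partial>lborel)"
    by (rule lborel_pair.Fubini') measurable
  also have "\<dots> = (\<integral>\<^sup>+y. ennreal (indicator {0<..} y * (1 / (pi * \<theta>) * stieltjes_integrand u y)) \<partial>lborel)"
  proof (intro nn_integral_cong)
    fix y :: real
    show "(\<integral>\<^sup>+x. ennreal (1 / pi * cut_integrand \<theta> lam \<beta> x y) * indicator {0<..} y
      * (ennreal (exp (- s * x)) * indicator {0<..} x) \<partial>lborel) =
      ennreal (indicator {0<..} y * (1 / (pi * \<theta>) * stieltjes_integrand u y))"
    proof (cases "0 < y")
      case True
      let ?k = "(y + u) / (pi * \<theta>) * stieltjes_integrand u y"
      have yu: "0 < y + u" using True u by simp
      have k: "0 \<le> ?k" using stieltjes(3)[OF u True] yu \<theta> by (intro mult_nonneg_nonneg) auto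
      have "(\<integral>\<^sup>+x. ennreal (1 / pi * cut_integrand \<theta> lam \<beta> x y) * indicator {0<..} y
          * (ennreal (exp (- s * x)) * indicator {0<..} x) \<partial>lborel) =
          (\<integral>\<^sup>+x. ennreal ?k * (ennreal (exp (- (y + u) * x)) * indicator {0<..} x) \<partial>lborel)"
      proof (intro nn_integral_cong)
        fix x :: real
        have "1 / pi * cut_integrand \<theta> lam \<beta> x y * exp (- s * x) =
            ?k * (exp (- (y + lam) * x) * exp (- s * x))"
          unfolding cut_integrand_eq[OF True u(1)] by simp
        also have "exp (- (y + lam) * x) * exp (- s * x) = exp (- (y + u) * x)"
          unfolding exp_add[symmetric] by (simp add: u_def algebra_simps)
        finally have "ennreal (1 / pi * cut_integrand \<theta> lam \<beta> x y) * ennreal (exp (- s * x)) =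
            ennreal ?k * ennreal (exp (- (y + u) * x))"
          using k cut_integrand_nonneg[OF True, of x] by (simp flip: ennreal_mult')
        then show "ennreal (1 / pi * cut_integrand \<theta> lam \<beta> x y) * indicator {0<..} y
            * (ennreal (exp (- s * x)) * indicator {0<..} x) =
            ennreal ?k * (ennreal (exp (- (y + u) * x)) * indicator {0<..} x)"
          using True by (simp add: mult.assoc[symmetric])
      qed
      also have "\<dots> = ennreal ?k * ennreal (1 / (y + u))"
        by (subst nn_integral_cmult) (simp, simp only: nn_integral_exp_half_line[OF yu])
      also have "\<dots> = ennreal (?k * (1 / (y + u)))"
        using k yu by (simp only: ennreal_mult')
      finally show ?thesis using True yu by simp
    qed simp
  qed
  also have "\<dots> = ennreal (LINT y|lborel. indicator {0<..} y * (1 / (pi * \<theta>) * stieltjes_integrand u y))"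
  proof (rule nn_integral_eq_integral)
    show "integrable lborel (\<lambda>y. indicator {0<..} y * (1 / (pi * \<theta>) * stieltjes_integrand u y))"
      using set_integrable_mult_right[OF stieltjes(1)[OF u], of "1 / (pi * \<theta>)"]
      by (simp add: set_integrable_def mult.commute)
    show "AE y in lborel. 0 \<le> indicator {0<..} y * (1 / (pi * \<theta>) * stieltjes_integrand u y)"
      using stieltjes(3)[OF u] \<theta> by (auto simp: indicator_def)
  qed
  also have "(LINT y|lborel. indicator {0<..} y * (1 / (pi * \<theta>) * stieltjes_integrand u y)) =
      1 / (pi * \<theta>) * (LINT y:{0<..}|lborel. stieltjes_integrand u y)"
    unfolding set_integral_mult_right[symmetric] by (simp add: set_lebesgue_integral_def)
  finally show ?thesis
    unfolding stieltjes(2)[OF u] unfolding s0_eq u_def by simp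
qed

text \<open>The residue contributions cancel, leaving
  \<open>1 / (\<theta> * ((s + lam) powr \<beta> + c))\<close>, which is the desired transform by
  the choice of \<open>c\<close>.\<close>

lemma nn_laplace_density:
  assumes s: "0 \<le> s"
  shows "(\<integral>\<^sup>+x. ennreal (pdf x) * ennreal (exp (- s * x)) \<partial>lborel) =
    ennreal (1 / (1 + \<theta> * ((s + lam) powr \<beta> - lam powr \<beta>)))"
proof -
  let ?I = "\<lambda>x. \<integral>\<^sup>+y. ennreal (1 / pi * cut_integrand \<theta> lam \<beta> x y) * indicator {0<..} y \<partial>lborel"
  let ?r = "if c < 0 then 1 / (\<beta> * s0 \<theta> lam \<beta> powr (\<beta> - 1) * (s + lam - s0 \<theta> lam \<beta>)) else 0"
  have [measurable]: "residue_term \<theta> lam \<beta> \<in> borel_measurable borel"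
    unfolding residue_term_def by measurable
  have "(\<integral>\<^sup>+x. ennreal (pdf x) * ennreal (exp (- s * x)) \<partial>lborel) =
      (\<integral>\<^sup>+x. ennreal (residue_term \<theta> lam \<beta> x * exp (- s * x)) * indicator {0<..} x +
        ?I x * (ennreal (exp (- s * x)) * indicator {0<..} x) \<partial>lborel)"
  proof (intro nn_integral_cong)
    fix x :: real
    show "ennreal (pdf x) * ennreal (exp (- s * x)) =
        ennreal (residue_term \<theta> lam \<beta> x * exp (- s * x)) * indicator {0<..} x +
        ?I x * (ennreal (exp (- s * x)) * indicator {0<..} x)"
    proof (cases "0 < x")
      case True
      then show ?thesis
        using residue_term_nonneg[of x] ennreal_innovation_density[OF True]
        by (simp add: pdf_def ennreal_mult distrib_right)
    qed (simp add: pdf_def)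
  qed
  also have "\<dots> = (\<integral>\<^sup>+x. ennreal (residue_term \<theta> lam \<beta> x * exp (- s * x)) * indicator {0<..} x \<partial>lborel) +
      (\<integral>\<^sup>+x. ?I x * (ennreal (exp (- s * x)) * indicator {0<..} x) \<partial>lborel)"
    by (rule nn_integral_add) measurable
  also have "\<dots> = ennreal (1 / \<theta> * ?r) + ennreal (1 / \<theta> * (1 / ((s + lam) powr \<beta> + c) - ?r))"
    unfolding nn_laplace_residue_term[OF s] nn_laplace_cut_integral[OF s] ..
  also have "\<dots> = ennreal (1 / \<theta> * ?r + 1 / \<theta> * (1 / ((s + lam) powr \<beta> + c) - ?r))"
  \<comment> \<open>Merging the two terms requires each to be nonnegative as a real number; the
    difference is so because it is a positive multiple of the integral of a nonnegative
    function.\<close>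
  proof (rule ennreal_plus[symmetric])
    show "0 \<le> 1 / \<theta> * ?r" using s0_less s \<theta> \<beta>_pos by auto
    have u: "0 < s + lam" "lam \<le> s + lam" using s lam by auto
    have "0 \<le> (LINT y:{0<..}|lborel. stieltjes_integrand (s + lam) y)"
      unfolding set_lebesgue_integral_def using stieltjes(3)[OF u]
      by (intro integral_nonneg_AE) (auto simp: indicator_def)
    then have "0 \<le> 1 / ((s + lam) powr \<beta> + c) - ?r"
      unfolding stieltjes(2)[OF u] s0_eq by (simp only: zero_le_mult_iff pi_gt_zero) (use pi_gt_zero in linarith)
    then show "0 \<le> 1 / \<theta> * (1 / ((s + lam) powr \<beta> + c) - ?r)" using \<theta> by (intro mult_nonneg_nonneg) auto
  qed
  also have "1 / \<theta> * ?r + 1 / \<theta> * (1 / ((s + lam) powr \<beta> + c) - ?r) = 1 / (\<theta> * ((s + lam) powr \<beta> + c))"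
    by (simp only: distrib_left[symmetric]) simp
  also have "\<theta> * ((s + lam) powr \<beta> + c) = 1 + \<theta> * ((s + lam) powr \<beta> - lam powr \<beta>)"
    using \<theta> by (simp add: c_def algebra_simps)
  finally show ?thesis .
qed

text \<open>The total mass is the transform at \<open>s = 0\<close>, which equals 1.\<close>

lemma prob_space_density: "prob_space (density lborel pdf)"
  using nn_laplace_density[of 0] by (intro prob_spaceI) (simp add: emeasure_density)

lemma laplace_transform_density:
  assumes s: "0 \<le> s"
  shows "laplace_transform (density lborel pdf) (\<lambda>x. x) s = 1 / (1 + \<theta> * ((s + lam) powr \<beta> - lam powr \<beta>))"
proof -
  have "lam powr \<beta> \<le> (s + lam) powr \<beta>" using s lam \<beta>_pos by (intro powr_mono2) auto
  then have pos: "0 \<le> 1 / (1 + \<theta> * ((s + lam) powr \<beta> - lam powr \<beta>))" using \<theta> by simp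
  have "laplace_transform (density lborel pdf) (\<lambda>x. x) s =
      enn2real (\<integral>\<^sup>+x. ennreal (exp (- s * x)) \<partial>density lborel pdf)"
    unfolding laplace_transform_def by (rule integral_eq_nn_integral) auto
  also have "(\<integral>\<^sup>+x. ennreal (exp (- s * x)) \<partial>density lborel pdf) =
      ennreal (1 / (1 + \<theta> * ((s + lam) powr \<beta> - lam powr \<beta>)))"
    using nn_laplace_density[OF s] by (subst nn_integral_density) simp_all
  finally show ?thesis using pos by simp
qed

text \<open>Both laws live on the nonnegative half line and have equal transforms at the positive
  integers, so \<open>laplace_transform_unique\<close> identifies them.\<close>

lemma distributed_of_laplace_transform:
  assumes "prob_space M" and X [measurable]: "X \<in> borel_measurable M" and X0: "AE \<omega> in M. 0 \<le> X \<omega>"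
    and L: "\<And>s. 0 < s \<Longrightarrow> laplace_transform M X s = 1 / (1 + \<theta> * ((s + lam) powr \<beta> - lam powr \<beta>))"
  shows "distributed M lborel X (\<lambda>x. ennreal (if 0 < x then innovation_density \<theta> lam \<beta> x else 0))"
proof -
  interpret prob_space M by fact
  have "distr M borel X = density lborel pdf"
  proof (rule laplace_transform_unique)
    show "prob_space (distr M borel X)" by (rule prob_space_distr) fact
    show "AE x in distr M borel X. 0 \<le> x" using X0 by (subst AE_distr_iff) auto
    show "AE x in density lborel pdf. 0 \<le> x" by (subst AE_density) (simp, simp add: pdf_def)
    fix k :: nat assume "1 \<le> k"
    then show "laplace_transform (distr M borel X) (\<lambda>x. x) (real k) =
        laplace_transform (density lborel pdf) (\<lambda>x. x) (real k)"
      using L[of "real k"] laplace_transform_density[of "real k"]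
      by (simp add: laplace_transform_def integral_distr)
  qed (simp_all add: prob_space_density)
  moreover have "distr M lborel X = distr M borel X" by (rule distr_cong) auto
  ultimately have "distributed M lborel X (\<lambda>x. ennreal (pdf x))"
    by (simp add: distributed_def)
  then show ?thesis by (simp only: pdf_def)
qed

end

section \<open>The innovations of the stationary process\<close>

theorem theorem3p2:
  fixes M :: "'a measure"
    and \<theta> lam \<beta> :: real
    and m :: nat
    and B :: "nat \<Rightarrow> 'a \<Rightarrow> bool"
    and \<epsilon> Y :: "nat \<Rightarrow> 'a \<Rightarrow> real"
  assumes "0 < \<theta>" "\<theta> < 1" "0 < lam" "2 \<le> m" "\<beta> = 1 / real m"
    and "ar1_process M \<theta> B \<epsilon> Y"
    and "prob_space.stationary M Y"
    and "\<And>n. geometric_tempered_stable M lam \<beta> (Y n)"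
    and "\<And>n s. 0 < s \<Longrightarrow>
      laplace_transform M (Y n) s = 1 / (1 + (s + lam) powr \<beta> - lam powr \<beta>)"
  shows "(\<forall>n\<ge>1. geometric_tempered_stable M lam \<beta> (\<epsilon> n) \<and>
            (\<forall>s>0. laplace_transform M (\<epsilon> n) s =
                    1 / (1 + \<theta> * ((s + lam) powr \<beta> - lam powr \<beta>)))) \<and>
         (\<forall>x>0. set_integrable lborel {0<..} (cut_integrand \<theta> lam \<beta> x)) \<and>
         (\<forall>n\<ge>1. distributed M lborel (\<epsilon> n)
            (\<lambda>x. ennreal (if 0 < x then innovation_density \<theta> lam \<beta> x else 0)))"
proof -
  interpret law: innovation_law \<theta> lam \<beta> m using assms by unfold_locales
  interpret ar1_process M \<theta> B \<epsilon> Y by fact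
  have Y: "AE \<omega> in M. 0 \<le> Y n \<omega>" for n
    using assms(8) by (simp add: geometric_tempered_stable_def)
  have laplace: "laplace_transform M (\<epsilon> n) s = 1 / (1 + \<theta> * ((s + lam) powr \<beta> - lam powr \<beta>))"
    if n: "1 \<le> n" and s: "0 < s" for n s
  proof -
    define g where "g = (s + lam) powr \<beta> - lam powr \<beta>"
    have "lam powr \<beta> \<le> (s + lam) powr \<beta>"
      using s assms(3) law.\<beta>_pos by (intro powr_mono2) auto
    then have g: "0 \<le> g" by (simp add: g_def)
    have pos: "0 < 1 + g" "0 < 1 + \<theta> * g" using g assms(1) by (simp_all add: add_pos_nonneg)
    \<comment> \<open>The transform of \<open>Y\<close> is the same at all times, so the recursion
      becomes a single linear equation for the transform of \<open>\<epsilon> n\<close>.\<close>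
    have \<phi>: "laplace_transform M (Y k) s = 1 / (1 + g)" for k
      using assms(9)[OF s] by (simp add: g_def)
    have "1 / (1 + g) = laplace_transform M (\<epsilon> n) s * (\<theta> + (1 - \<theta>) * (1 / (1 + g)))"
      using laplace_transform_recursion[OF n assms(1) Y less_imp_le[OF s]] unfolding \<phi> .
    also have "\<theta> + (1 - \<theta>) * (1 / (1 + g)) = (1 + \<theta> * g) / (1 + g)"
      using pos by (simp add: field_simps)
    finally have "laplace_transform M (\<epsilon> n) s * (1 + \<theta> * g) = 1"
      using pos by simp
    then show ?thesis using pos by (simp add: g_def field_simps)
  qed
  have nonneg: "AE \<omega> in M. 0 \<le> \<epsilon> n \<omega>" if "1 \<le> n" for n
    by (rule innovation_nonneg[OF that assms(1) Y])
  show ?thesis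
  proof (intro conjI allI impI)
    fix n :: nat assume n: "1 \<le> n"
    \<comment> \<open>The scale of the innovations within the family is
      \<open>\<theta>\<close>.\<close>
    show "geometric_tempered_stable M lam \<beta> (\<epsilon> n)"
      unfolding geometric_tempered_stable_def
      using innovation_measurable[OF n] nonneg[OF n] laplace[OF n] assms(1) by blast
    show "distributed M lborel (\<epsilon> n)
        (\<lambda>x. ennreal (if 0 < x then innovation_density \<theta> lam \<beta> x else 0))"
      by (rule law.distributed_of_laplace_transform[OF prob_space_axioms innovation_measurable[OF n]
          nonneg[OF n] laplace[OF n]])
  qed (auto intro: laplace law.set_integrable_cut_integrand)
qed

end
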